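(* Let $U\subset\mathbb{R}^n$ be open and convex, and let $f:U\to\mathbb{R}$ be a convex function such that $f\notin C^{1,1}_{\mathrm{loc}}(U)$. Then the following statements are equivalent: (1) For every $\varepsilon>0$ there exists a convex function $g\in C^{1,1}_{\mathrm{loc}}(U)$ such that $|\{x\in U:\ f(x)\neq g(x)\}|<\varepsilon$. (2) The graph of $f$ does not contain any line of $\mathbb{R}^{n+1}$. Moreover, if the graph of $f$ contains no lines, then for every $\varepsilon>0$ the function $g$ in (1) can be found so that, in addition, $g\ge f$.
   Context: $|E|$ denotes the Lebesgue measure of $E\subset\mathbb{R}^n$. $g\in C^{1,1}_{\mathrm{loc}}(U)$ means that $g\in C^1(U)$ and its derivative $Dg$ is locally Lipschitz continuous on $U$. The graph of $f$ is $\{(x,f(x)):x\in U\}\subset\mathbb{R}^{n+1}$. A line is a set isometric to $\mathbb{R}$ (a full straight line; a half-line is not a line). *)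

theory Defs
  imports "HOL-Analysis.Analysis"
begin

text \<open>Intended for open \<open>U\<close>, where \<open>at x\<close> and \<open>at x within U\<close> agree. The values of \<open>g\<close>
  outside \<open>U\<close> play no role. The derivative is compared in the operator norm.\<close>

definition C11_loc_on :: "'a::euclidean_space set \<Rightarrow> ('a \<Rightarrow> real) \<Rightarrow> bool" where
  "C11_loc_on U g \<longleftrightarrow>
     (\<exists>Dg :: 'a \<Rightarrow> 'a \<Rightarrow>\<^sub>L real.
        (\<forall>x\<in>U. (g has_derivative blinfun_apply (Dg x)) (at x)) \<and>
        continuous_on U Dg \<and>
        (\<forall>x\<in>U. \<exists>r>0. \<exists>L. L-lipschitz_on (ball x r \<inter> U) Dg))"

definition graph_on :: "'a set \<Rightarrow> ('a \<Rightarrow> 'b) \<Rightarrow> ('a \<times> 'b) set" where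
  "graph_on U f = {(x, f x) |x. x \<in> U}"

definition is_line :: "'a::metric_space set \<Rightarrow> bool" where
  "is_line l \<longleftrightarrow> (\<exists>\<gamma> :: real \<Rightarrow> 'a. range \<gamma> = l \<and> (\<forall>s t. dist (\<gamma> s) (\<gamma> t) = dist s t))"

text \<open>The ambient space of a graph is \<open>(real ^ 'n) \<times> real\<close>: the library's product metric is
  the Euclidean one, so this is Euclidean space of dimension \<open>CARD('n) + 1\<close>.\<close>

end

theory Submission
  imports Defs
begin

text \<open>If the graph contains a line, then \<open>f\<close> is affine along its direction through every point of \<open>U\<close>.
  A convex \<open>g\<close> that differs from \<open>f\<close> on a set of finite measure must then agree with \<open>f\<close> everywhere,
  so \<open>f\<close> would itself be of class \<open>C\<^sup>1\<^sup>,\<^sup>1\<close>.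

  If the graph contains no line, the domain of the conjugate of \<open>f\<close> has interior, so after
  subtracting an affine function the sublevel sets of \<open>f\<close> are bounded. Taking the maximum with steep
  functions of the distance to the boundary changes \<open>f\<close> on a small set and makes the sublevel sets
  compact in \<open>U\<close>. Now let \<open>g\<close> be the lower boundary of the union of all balls inside the epigraph whose
  radius is at least a positive convex decreasing function of the height of their centre. The union
  is convex, and at bounded height its boundary points are touched by interior balls of a uniform
  radius, which makes \<open>g\<close> locally \<open>C\<^sup>1\<^sup>,\<^sup>1\<close>. Moreover \<open>g = f\<close> wherever the graph of \<open>f\<close> is touched by an
  interior ball of admissible radius, and almost every point is touched by some ball: for
  \<open>\<kappa> \<rightarrow> \<infinity>\<close>, the paraboloids of opening \<open>\<kappa>\<close> that touch \<open>f\<close> from above have centres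
  filling almost a whole ball, and the map from contact points to centres is nonexpansive.\<close>

section \<open>Subgradients and functions of class \<open>C\<^sup>1\<^sup>,\<^sup>1\<close>\<close>

text \<open>A single radius cannot serve all of \<open>U\<close>: the balls that touch most of the
  graph may have to shrink towards infinity and towards the boundary. Admitting every radius
  everywhere would only give back \<open>f\<close>. Height is a suitable parameter for two reasons.
  Compact sublevel sets have finite measure, so each level can spend its own share of \<epsilon> on
  its own radius; and a lower bound for the radius that is convex in the centre keeps the union of
  balls convex. This is why the tilt and the steepening at the boundary come before the balls. Both
  the steepening and the balls only raise the function, so \<open>g \<ge> f\<close> comes with the
  construction.

  That almost every point is touched would also follow from Alexandrov's theorem on second
  derivatives; the nonexpansive map from contact points to centres gives this much from measure
  theory alone.

  For the converse, finite measure is what counts: far out along the line direction little room is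
  left for disagreement, and translation carries this back to every point.\<close>

definition subgradient_on :: "'a::euclidean_space set \<Rightarrow> ('a \<Rightarrow> real) \<Rightarrow> 'a \<Rightarrow> 'a \<Rightarrow> bool" where
  "subgradient_on U f x p \<longleftrightarrow> (\<forall>y\<in>U. f x + p \<bullet> (y - x) \<le> f y)"

text \<open>The open ray below \<open>(x, f x)\<close> is disjoint from the epigraph; the slope of a
  separating hyperplane is a subgradient.\<close>

lemma convex_on_subgradient_exists:
  fixes f :: "'a::euclidean_space \<Rightarrow> real"
  assumes U: "open U" and f: "convex_on U f" and x: "x \<in> U"
  obtains p where "subgradient_on U f x p"
proof -
  let ?S = "{x} \<times> {..<f x}"
  have "\<exists>a b. a \<noteq> 0 \<and> (\<forall>z\<in>?S. a \<bullet> z \<le> b) \<and> (\<forall>z\<in>epigraph U f. b \<le> a \<bullet> z)"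
  proof (rule separating_hyperplane_sets)
    show "convex ?S"
      by (intro convex_Times) auto
    show "convex (epigraph U f)"
      using f by (simp add: convex_epigraph)
    show "?S \<noteq> {}"
      by (auto intro: lt_ex)
    show "epigraph U f \<noteq> {}"
      using x by (force simp: epigraph_def)
  qed (auto simp: epigraph_def)
  then obtain c b where "c \<noteq> 0" and sep: "\<forall>z\<in>?S. c \<bullet> z \<le> b" "\<forall>z\<in>epigraph U f. b \<le> c \<bullet> z"
    by blast
  define a \<alpha> where "a = fst c" and "\<alpha> = snd c"
  have nz: "(a, \<alpha>) \<noteq> 0" using \<open>c \<noteq> 0\<close> by (simp add: a_def \<alpha>_def)
  have lo: "a \<bullet> x + \<alpha> * s \<le> b" if "s < f x" for s
    using sep(1) that by (auto simp: a_def \<alpha>_def inner_prod_def)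
  have hi: "b \<le> a \<bullet> y + \<alpha> * t" if "y \<in> U" "f y \<le> t" for y t
    using bspec[OF sep(2), of "(y, t)"] that by (auto simp: a_def \<alpha>_def inner_prod_def mem_epigraph)
  have "\<alpha> \<ge> 0"
    using lo[of "f x - 1"] hi[OF x order_refl] by (simp add: algebra_simps)
  have le: "a \<bullet> x + \<alpha> * f x \<le> a \<bullet> y + \<alpha> * f y" if "y \<in> U" for y
  proof (rule field_le_epsilon)
    fix e :: real assume "e > 0"
    have "a \<bullet> x + \<alpha> * (f x - e / (\<alpha> + 1)) \<le> a \<bullet> y + \<alpha> * f y"
      using lo[of "f x - e / (\<alpha> + 1)"] hi[OF that order_refl] \<open>e > 0\<close> \<open>\<alpha> \<ge> 0\<close> by auto
    moreover have "\<alpha> * (e / (\<alpha> + 1)) \<le> e"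
      using \<open>e > 0\<close> \<open>\<alpha> \<ge> 0\<close> by (simp add: field_simps)
    ultimately show "a \<bullet> x + \<alpha> * f x \<le> a \<bullet> y + \<alpha> * f y + e"
      by (simp add: algebra_simps)
  qed
  \<comment> \<open>A vertical separator would make \<open>a \<bullet> y\<close> minimal over
    \<open>U\<close> at the interior point \<open>x\<close>; a step against \<open>a\<close> refutes
    this.\<close>
  have "\<alpha> > 0"
  proof (rule ccontr)
    assume "\<not> \<alpha> > 0"
    with \<open>\<alpha> \<ge> 0\<close> have \<alpha>: "\<alpha> = 0" by simp
    obtain e where "e > 0" and e: "cball x e \<subseteq> U"
      using U x open_contains_cball by blast
    have "a \<noteq> 0" using nz \<alpha> by (auto simp: zero_prod_def)
    define y where "y = x - (e / norm a) *\<^sub>R a"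
    have "y \<in> U"
      using e \<open>e > 0\<close> \<open>a \<noteq> 0\<close> by (auto simp: y_def dist_norm subset_iff)
    from le[OF this] have "(e / norm a) * (a \<bullet> a) \<le> 0"
      by (simp add: \<alpha> y_def inner_diff_right)
    moreover have "(e / norm a) * (a \<bullet> a) > 0"
      using \<open>e > 0\<close> \<open>a \<noteq> 0\<close> by (intro mult_pos_pos) auto
    ultimately show False by simp
  qed
  show thesis
  proof
    show "subgradient_on U f x ((-1 / \<alpha>) *\<^sub>R a)"
      unfolding subgradient_on_def
    proof
      fix y assume "y \<in> U"
      from le[OF this] show "f x + ((-1 / \<alpha>) *\<^sub>R a) \<bullet> (y - x) \<le> f y"
        using \<open>\<alpha> > 0\<close> by (simp add: field_simps inner_diff_right)
    qed
  qed
qed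

text \<open>Tested at distance \<open>d\<close> in the direction of \<open>p\<close>, where the
  affine minorant has risen by \<open>d * norm p\<close>.\<close>

lemma subgradient_on_norm_le:
  assumes p: "subgradient_on U f x p" and d: "d \<ge> 0" "cball x d \<subseteq> U"
    and M: "\<And>y. y \<in> cball x d \<Longrightarrow> f y \<le> M"
  shows "d * norm p \<le> M - f x"
proof (cases "p = 0")
  case True
  then show ?thesis using M[of x] d by auto
next
  case False
  define y where "y = x + (d / norm p) *\<^sub>R p"
  have y: "y \<in> cball x d"
    using d False by (simp add: y_def dist_norm)
  have "p \<bullet> (y - x) = d * norm p"
    using False by (simp add: y_def dot_square_norm power2_eq_square)
  moreover have "f x + p \<bullet> (y - x) \<le> f y"
    using p y d unfolding subgradient_on_def by blast
  ultimately show ?thesis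
    using M[OF y] by simp
qed

lemma convex_on_locally_bounded_subgradient:
  fixes f :: "'a::euclidean_space \<Rightarrow> real"
  assumes U: "open U" and f: "convex_on U f" and x0: "x0 \<in> U"
  obtains R L where "R > 0" "L > 0" "cball x0 R \<subseteq> U"
    "\<forall>x\<in>cball x0 R. \<forall>p. subgradient_on U f x p \<longrightarrow> norm p \<le> L"
    "\<forall>x\<in>cball x0 R. \<forall>y\<in>cball x0 R. \<bar>f x - f y\<bar> \<le> L * dist x y"
    "\<forall>x\<in>cball x0 R. \<bar>f x\<bar> \<le> L"
proof -
  obtain e where "e > 0" and e: "cball x0 e \<subseteq> U"
    using U x0 open_contains_cball by blast
  have "continuous_on (cball x0 e) f"
    using convex_on_continuous[OF U f] e continuous_on_subset by blast
  then have "bounded (f ` cball x0 e)"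
    by (intro compact_imp_bounded compact_continuous_image) auto
  then obtain B where B: "\<And>x. x \<in> cball x0 e \<Longrightarrow> \<bar>f x\<bar> \<le> B"
    unfolding bounded_iff by (metis image_eqI real_norm_def)
  have "B \<ge> 0" using B[of x0] \<open>e > 0\<close> by force
  \<comment> \<open>Around each point of \<open>cball x0 R\<close> there is still a ball of radius
    \<open>R\<close> on which \<open>\<bar>f\<bar>\<close> is at most \<open>B\<close>, so slopes
    are at most \<open>2 * B / R\<close>. The other summands of \<open>L\<close> bound the values
    and make \<open>L\<close> positive.\<close>
  define R where "R = e / 2"
  define L where "L = 2 * B / R + B + 1"
  have "R > 0" using \<open>e > 0\<close> by (simp add: R_def)
  have "L > 0" using \<open>B \<ge> 0\<close> \<open>R > 0\<close> by (simp add: L_def add_nonneg_pos)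
  have sub: "cball x R \<subseteq> cball x0 e" if "x \<in> cball x0 R" for x
  proof
    fix y assume "y \<in> cball x R"
    then show "y \<in> cball x0 e"
      using that dist_triangle[of x0 y x] by (simp add: R_def)
  qed
  have R: "cball x0 R \<subseteq> cball x0 e" using \<open>e > 0\<close> by (auto simp: R_def)
  have 1: "norm p \<le> L" if x: "x \<in> cball x0 R" and p: "subgradient_on U f x p" for x p
  proof -
    have "R * norm p \<le> B - f x"
    proof (rule subgradient_on_norm_le[OF p])
      show "cball x R \<subseteq> U" using sub[OF x] e by blast
      show "f y \<le> B" if "y \<in> cball x R" for y
        using B[of y] that sub[OF x] by auto
    qed (use \<open>R > 0\<close> in simp)
    also have "\<dots> \<le> 2 * B" using B[of x] x R by auto
    finally have "norm p \<le> 2 * B / R" using \<open>R > 0\<close> by (simp add: field_simps)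
    then show ?thesis using \<open>B \<ge> 0\<close> by (simp add: L_def)
  qed
  have 2: "f x - f y \<le> L * dist x y" if x: "x \<in> cball x0 R" and y: "y \<in> cball x0 R" for x y
  proof -
    obtain p where p: "subgradient_on U f x p"
      using convex_on_subgradient_exists[OF U f] x R e by blast
    then have "f x - f y \<le> p \<bullet> (x - y)"
      using y R e by (fastforce simp: subgradient_on_def inner_diff_right)
    also have "\<dots> \<le> norm p * norm (x - y)" by (rule norm_cauchy_schwarz)
    also have "\<dots> \<le> L * dist x y"
      using 1[OF x p] by (simp add: dist_norm mult_right_mono)
    finally show ?thesis .
  qed
  show thesis
  proof
    have "\<bar>f x\<bar> \<le> L" if "x \<in> cball x0 R" for x
    proof -
      have "\<bar>f x\<bar> \<le> B" using B that R by blast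
      moreover have "0 \<le> 2 * B / R" using \<open>B \<ge> 0\<close> \<open>R > 0\<close> by simp
      ultimately show ?thesis by (simp add: L_def)
    qed
    then show "\<forall>x\<in>cball x0 R. \<bar>f x\<bar> \<le> L" by blast
    show "\<forall>x\<in>cball x0 R. \<forall>y\<in>cball x0 R. \<bar>f x - f y\<bar> \<le> L * dist x y"
      using 2 by (fastforce simp: abs_le_iff dist_commute simp del: mem_cball)
  qed (use 1 \<open>R > 0\<close> \<open>L > 0\<close> R e in auto)
qed

text \<open>Convexity turns an upper bound on one side of \<open>z\<close> into a lower bound on the
  other: \<open>z\<close> lies between \<open>w\<close> and the reflected point
  \<open>z - t *\<^sub>R (w - z)\<close>. The quadratic error disappears after division by
  \<open>t\<close> as \<open>t\<close> tends to 0.\<close>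

lemma subgradient_of_upper_paraboloid:
  fixes f :: "'a::euclidean_space \<Rightarrow> real"
  assumes f: "convex_on S f" and z: "z \<in> interior S"
    and up: "\<And>w. w \<in> S \<Longrightarrow> f w \<le> f z + p \<bullet> (w - z) + C * (norm (w - z))\<^sup>2"
  shows "subgradient_on S f z p"
  unfolding subgradient_on_def
proof
  fix w assume w: "w \<in> S"
  have zS: "z \<in> S" using z interior_subset by auto
  obtain e where "e > 0" and e: "cball z e \<subseteq> S"
    using z by (meson interior_subset mem_interior_cball)
  define N where "N = norm (w - z)"
  have key: "f z + p \<bullet> (w - z) - t * (C * N\<^sup>2) \<le> f w" if t: "t > 0" "t * N \<le> e" for t
  proof -
    define v where "v = z - t *\<^sub>R (w - z)"
    have v: "v \<in> S" using e t by (auto simp: v_def N_def dist_norm subset_iff)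
    have "z = (1 / (1 + t)) *\<^sub>R v + (t / (1 + t)) *\<^sub>R w"
    proof -
      have "(1 + t) *\<^sub>R z = v + t *\<^sub>R w" by (simp add: v_def algebra_simps)
      then have "(1 / (1 + t)) *\<^sub>R ((1 + t) *\<^sub>R z) = (1 / (1 + t)) *\<^sub>R (v + t *\<^sub>R w)" by simp
      then show ?thesis using t by (simp add: scaleR_add_right)
    qed
    then have "f z \<le> (1 / (1 + t)) * f v + (t / (1 + t)) * f w"
      using f v w t unfolding convex_on_def
      by (smt (verit, best) add_divide_distrib divide_nonneg_pos div_self)
    also have "\<dots> = (f v + t * f w) / (1 + t)" by (simp add: add_divide_distrib)
    finally have "(1 + t) * f z \<le> f v + t * f w"
      using t by (simp add: pos_le_divide_eq mult.commute)
    moreover have "f v \<le> f z - t * (p \<bullet> (w - z)) + C * (t * N)\<^sup>2"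
      using up[OF v] t by (simp add: v_def N_def power_mult_distrib)
    ultimately have "t * (f z + p \<bullet> (w - z) - t * (C * N\<^sup>2)) \<le> t * f w"
      by (simp add: algebra_simps power2_eq_square)
    then show ?thesis using t by simp
  qed
  have "((\<lambda>t. f z + p \<bullet> (w - z) - t * (C * N\<^sup>2)) \<longlongrightarrow> f z + p \<bullet> (w - z) - 0 * (C * N\<^sup>2)) (at_right 0)"
    by (intro tendsto_intros)
  moreover have "\<forall>\<^sub>F t in at_right 0. f z + p \<bullet> (w - z) - t * (C * N\<^sup>2) \<le> f w"
    unfolding eventually_at_right_field
  proof (intro exI conjI allI impI)
    have "N \<ge> 0" by (simp add: N_def)
    then show "e / (N + 1) > 0" using \<open>e > 0\<close> by simp
    fix t assume t: "0 < t" "t < e / (N + 1)"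
    then have "t * (N + 1) \<le> e" using \<open>N \<ge> 0\<close> by (simp add: field_simps)
    then have "t * N \<le> e" using t by (simp add: algebra_simps)
    then show "f z + p \<bullet> (w - z) - t * (C * N\<^sup>2) \<le> f w" using key t by blast
  qed
  ultimately show "f z + p \<bullet> (w - z) \<le> f w"
    using tendsto_upperbound by fastforce
qed

text \<open>Subgradients below and paraboloids above pinch \<open>G\<close>, so it is
  differentiable. As \<open>d\<close> and \<open>C\<close> are uniform near \<open>x0\<close>, the
  gradient is \<open>4 * C\<close>-Lipschitz there: the upper bound at \<open>x\<close> and the
  subgradient inequality at \<open>y\<close> are compared at the common point
  \<open>y + v\<close>.\<close>

lemma C11_loc_on_of_quadratic_bounds:
  fixes G :: "'a::euclidean_space \<Rightarrow> real"
  assumes U: "open U"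
    and quad: "\<And>x0. x0 \<in> U \<Longrightarrow> \<exists>d>0. \<exists>C\<ge>0. \<forall>x\<in>ball x0 d. \<exists>p. subgradient_on U G x p \<and>
      (\<forall>h. norm h \<le> d \<longrightarrow> x + h \<in> U \<and> G (x + h) \<le> G x + p \<bullet> h + C * (norm h)\<^sup>2)"
  shows "C11_loc_on U G"
proof -
  have "\<exists>p. subgradient_on U G x p \<and>
      (\<exists>d>0. \<exists>C\<ge>0. \<forall>h. norm h \<le> d \<longrightarrow> x + h \<in> U \<and> G (x + h) \<le> G x + p \<bullet> h + C * (norm h)\<^sup>2)"
    if "x \<in> U" for x
    using quad[OF that] by (metis centre_in_ball)
  then obtain P where P: "\<And>x. x \<in> U \<Longrightarrow> subgradient_on U G x (P x)"
    and Pq: "\<And>x. x \<in> U \<Longrightarrow> \<exists>d>0. \<exists>C\<ge>0. \<forall>h. norm h \<le> d \<longrightarrow> x + h \<in> U \<and>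
        G (x + h) \<le> G x + P x \<bullet> h + C * (norm h)\<^sup>2"
    by metis
  have deriv: "(G has_derivative blinfun_apply (blinfun_inner_left (P x))) (at x)" if x: "x \<in> U" for x
  proof -
    obtain d C where "d > 0" "C \<ge> 0" and up: "\<And>h. norm h \<le> d \<Longrightarrow> x + h \<in> U \<and>
        G (x + h) \<le> G x + P x \<bullet> h + C * (norm h)\<^sup>2"
      using Pq[OF x] by metis
    have bound: "\<bar>G y - G x - P x \<bullet> (y - x)\<bar> \<le> C * (norm (y - x))\<^sup>2" if "norm (y - x) \<le> d" for y
    proof -
      have "y \<in> U" using up[OF that] by simp
      then have "0 \<le> G y - G x - P x \<bullet> (y - x)"
        using P[OF x] by (auto simp: subgradient_on_def)
      then show ?thesis using up[OF that] by simp
    qed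
    have "((\<lambda>y. (G y - G x - P x \<bullet> (y - x)) /\<^sub>R norm (y - x)) \<longlongrightarrow> 0) (at x)"
    proof (rule Lim_null_comparison)
      show "((\<lambda>y. C * norm (y - x)) \<longlongrightarrow> 0) (at x)"
        by (auto intro!: tendsto_eq_intros)
      show "\<forall>\<^sub>F y in at x. norm ((G y - G x - P x \<bullet> (y - x)) /\<^sub>R norm (y - x)) \<le> C * norm (y - x)"
        unfolding eventually_at
      proof (intro exI conjI ballI impI)
        show "d > 0" by fact
        fix y assume "y \<in> UNIV" "y \<noteq> x \<and> dist y x < d"
        then show "norm ((G y - G x - P x \<bullet> (y - x)) /\<^sub>R norm (y - x)) \<le> C * norm (y - x)"
          using bound[of y] by (simp add: dist_norm divide_simps power2_eq_square mult.assoc)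
      qed
    qed
    then show ?thesis
      unfolding has_derivative_at_within
      by (auto simp: bounded_linear_inner_right inner_commute intro: blinfun.bounded_linear_right)
  qed
  have lip: "\<exists>r>0. \<exists>L. L-lipschitz_on (ball x0 r) (\<lambda>x. blinfun_inner_left (P x))" if x0: "x0 \<in> U" for x0
  proof -
    obtain d C where "d > 0" "C \<ge> 0" and q: "\<And>x. x\<in>ball x0 d \<Longrightarrow> \<exists>p. subgradient_on U G x p \<and>
      (\<forall>h. norm h \<le> d \<longrightarrow> x + h \<in> U \<and> G (x + h) \<le> G x + p \<bullet> h + C * (norm h)\<^sup>2)"
      using quad[OF x0] by metis
    have inU: "x \<in> U" if "x \<in> ball x0 d" for x
      using q[OF that] \<open>d > 0\<close> by (metis add.right_neutral less_imp_le norm_zero)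
    \<comment> \<open>The local hypothesis brings its own subgradient; uniqueness identifies it with
      the globally chosen \<open>P x\<close>.\<close>
    have unique: "p = q" if "x \<in> U" "subgradient_on U G x p" "subgradient_on U G x q" for x p q
    proof -
      have "p' = P x" if sub: "subgradient_on U G x p'" for p'
      proof -
        obtain d C where "d > 0" "C \<ge> 0" and up: "\<And>h. norm h \<le> d \<Longrightarrow> x + h \<in> U \<and>
            G (x + h) \<le> G x + P x \<bullet> h + C * (norm h)\<^sup>2"
          using Pq[OF \<open>x \<in> U\<close>] by metis
        define w where "w = p' - P x"
        show ?thesis
        proof (rule ccontr)
          assume "p' \<noteq> P x"
          then have "norm w > 0" by (simp add: w_def)
          \<comment> \<open>The gap between two subgradients is linear in \<open>t\<close>, the
            paraboloid quadratic, so a small \<open>t\<close> separates them.\<close>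
          define t where "t = min (d / norm w) (1 / (2 * (C + 1)))"
          have t: "t > 0" using \<open>d > 0\<close> \<open>norm w > 0\<close> \<open>C \<ge> 0\<close> by (simp add: t_def)
          have "t \<le> d / norm w" by (simp add: t_def)
          then have "norm (t *\<^sub>R w) \<le> d" using \<open>norm w > 0\<close> t by (simp add: field_simps)
          from up[OF this] sub have "p' \<bullet> (t *\<^sub>R w) \<le> P x \<bullet> (t *\<^sub>R w) + C * (norm (t *\<^sub>R w))\<^sup>2"
            by (fastforce simp: subgradient_on_def)
          moreover have "p' \<bullet> (t *\<^sub>R w) = P x \<bullet> (t *\<^sub>R w) + t * (w \<bullet> w)"
            by (simp add: w_def inner_diff_left algebra_simps)
          ultimately have "t * (w \<bullet> w) \<le> C * (t * norm w)\<^sup>2"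
            using t by simp
          then have "t * (norm w)\<^sup>2 * 1 \<le> t * (norm w)\<^sup>2 * (C * t)"
            by (simp add: power_mult_distrib power2_eq_square mult_ac flip: power2_norm_eq_inner)
          then have "1 \<le> C * t"
            using t \<open>norm w > 0\<close> by (simp add: mult_le_cancel_left_pos)
          moreover have "t \<le> 1 / (2 * (C + 1))" by (simp add: t_def)
          then have "2 * (C + 1) * t \<le> 1" using \<open>C \<ge> 0\<close> by (simp add: field_simps)
          then have "C * t < 1" using t \<open>1 \<le> C * t\<close> by (simp add: algebra_simps)
          ultimately show False by simp
        qed
      qed
      then show ?thesis using that by metis
    qed
    \<comment> \<open>Radius \<open>d/4\<close> keeps \<open>2 * norm (y - x)\<close> below
      \<open>d\<close>, the range of the upper bound at \<open>x\<close>.\<close>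
    have Pb: "norm (P y - P x) \<le> 4 * C * norm (y - x)" if x: "x \<in> ball x0 (d/4)" and y: "y \<in> ball x0 (d/4)" for x y
    proof (cases "P y = P x")
      case True
      then show ?thesis using \<open>C \<ge> 0\<close> by simp
    next
      case False
      then have "x \<noteq> y" by auto
      have xd: "x \<in> ball x0 d" and yd: "y \<in> ball x0 d" using x y \<open>d > 0\<close> by auto
      have up: "x + h \<in> U \<and> G (x + h) \<le> G x + P x \<bullet> h + C * (norm h)\<^sup>2" if "norm h \<le> d" for h
        using q[OF xd] unique[OF inU[OF xd]] P[OF inU[OF xd]] that by metis
      define e where "e = norm (y - x)"
      have "e > 0" using \<open>x \<noteq> y\<close> by (simp add: e_def)
      have "dist y x < d / 2"
        using x y dist_triangle_half_l[of y x0 "d/2" x] by (simp add: dist_commute)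
      then have ed: "2 * e \<le> d" by (simp add: e_def dist_norm)
      \<comment> \<open>A step along the gradient difference, as long as \<open>y - x\<close>: the
        linear gain is then \<open>e * norm (P y - P x)\<close> against an error of order
        \<open>e\<^sup>2\<close>.\<close>
      define v where "v = (e / norm (P y - P x)) *\<^sub>R (P y - P x)"
      have nv: "norm v = e" using False \<open>e > 0\<close> by (simp add: v_def)
      define h where "h = (y - x) + v"
      have nh: "norm h \<le> 2 * e" using norm_triangle_ineq[of "y - x" v] by (simp add: h_def nv e_def)
      have "norm h \<le> d" using nh ed by simp
      from up[OF this] have A: "x + h \<in> U" "G (x + h) \<le> G x + P x \<bullet> h + C * (2 * e)\<^sup>2"
        using mult_left_mono[OF power_mono[OF nh, of 2] \<open>C \<ge> 0\<close>] by auto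
      have "G y + P y \<bullet> v \<le> G (x + h)"
        using P[OF inU[OF yd]] A(1) by (fastforce simp: subgradient_on_def h_def algebra_simps)
      moreover have "G x + P x \<bullet> (y - x) \<le> G y"
        using P[OF inU[OF xd]] inU[OF yd] by (simp add: subgradient_on_def)
      ultimately have "(P y - P x) \<bullet> v \<le> C * (2 * e)\<^sup>2"
        using A(2) by (simp add: h_def inner_add_right inner_diff_left)
      moreover have "(P y - P x) \<bullet> v = e * norm (P y - P x)"
        using False by (simp add: v_def dot_square_norm power2_eq_square)
      ultimately have "e * norm (P y - P x) \<le> e * (4 * C * e)"
        by (simp add: power2_eq_square algebra_simps)
      then show ?thesis using \<open>e > 0\<close> by (simp add: e_def)
    qed
    have "(4 * C)-lipschitz_on (ball x0 (d/4)) (\<lambda>x. blinfun_inner_left (P x))"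
    proof (rule lipschitz_onI)
      fix x y assume xy: "x \<in> ball x0 (d/4)" "y \<in> ball x0 (d/4)"
      have "norm (blinfun_inner_left (P x) - blinfun_inner_left (P y)) \<le> norm (P x - P y)"
      proof (rule norm_blinfun_bound)
        fix v
        show "norm (blinfun_apply (blinfun_inner_left (P x) - blinfun_inner_left (P y)) v) \<le> norm (P x - P y) * norm v"
          using Cauchy_Schwarz_ineq2[of "P x - P y" v]
          by (simp add: blinfun.diff_left inner_diff_left inner_diff_right inner_commute)
      qed simp
      then show "dist (blinfun_inner_left (P x)) (blinfun_inner_left (P y)) \<le> 4 * C * dist x y"
        using Pb[OF xy(2) xy(1)] by (simp add: dist_norm)
    qed (use \<open>C \<ge> 0\<close> in simp)
    then show ?thesis using \<open>d > 0\<close> by (intro exI[of _ "d/4"]) auto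
  qed
  show ?thesis
    unfolding C11_loc_on_def
  proof (intro exI[of _ "\<lambda>x. blinfun_inner_left (P x)"] conjI ballI)
    show "continuous_on U (\<lambda>x. blinfun_inner_left (P x))"
      unfolding continuous_on_eq_continuous_at[OF U]
    proof
      fix x assume "x \<in> U"
      then obtain r L where "r > 0" "L-lipschitz_on (ball x r) (\<lambda>x. blinfun_inner_left (P x))"
        using lip by blast
      then show "isCont (\<lambda>x. blinfun_inner_left (P x)) x"
        using lipschitz_on_continuous_on continuous_on_eq_continuous_at[OF open_ball] by (metis centre_in_ball)
    qed
    show "\<exists>r>0. \<exists>L. L-lipschitz_on (ball x r \<inter> U) (\<lambda>x. blinfun_inner_left (P x))" if "x \<in> U" for x
      using lip[OF that] lipschitz_on_subset by (metis Int_lower1)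
  qed (use deriv in auto)
qed

section \<open>Points touched by an interior ball\<close>

text \<open>Disjoint Vitali balls inside \<open>V\<close> cover almost all of \<open>S\<close>. The
  image of the part of \<open>S\<close> in such a ball lies in a ball of the same radius about the
  image of the centre, hence of the same measure. The remaining null set has a null image because
  \<open>T\<close> is Lipschitz on it.\<close>

lemma measure_le_of_nonexpansive_image:
  fixes T :: "'a::euclidean_space \<Rightarrow> 'a"
  assumes S: "S \<in> lmeasurable" and Y: "Y \<in> lmeasurable" and sub: "Y \<subseteq> T ` S"
    and T: "\<And>x y. x \<in> S \<Longrightarrow> y \<in> S \<Longrightarrow> dist (T x) (T y) \<le> dist x y"
  shows "measure lebesgue Y \<le> measure lebesgue S"
proof (rule field_le_epsilon)
  fix e :: real assume "e > 0"
  obtain V where V: "open V" "S \<subseteq> V" "V - S \<in> lmeasurable" "emeasure lebesgue (V - S) < ennreal e"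
    using sets_lebesgue_outer_open[OF fmeasurableD[OF S] \<open>e > 0\<close>] by blast
  have Veq: "V = S \<union> (V - S)" using V by auto
  have Vm: "V \<in> lmeasurable" using S V(3) by (subst Veq) (rule fmeasurable.Un)
  have "measure lebesgue (V - S) < e"
    using V(3,4) \<open>e > 0\<close> by (simp add: emeasure_eq_measure2 ennreal_less_iff)
  moreover have "measure lebesgue V \<le> measure lebesgue S + measure lebesgue (V - S)"
    using measure_Un_le[of S lebesgue "V - S"] S V(3) Veq by (metis fmeasurableD)
  ultimately have mV: "measure lebesgue V \<le> measure lebesgue S + e" by simp
  define K where "K = {(x, r). x \<in> S \<and> 0 < r \<and> cball x r \<subseteq> V}"
  obtain C where C: "countable C" "C \<subseteq> K"
    and disj: "pairwise (\<lambda>i j. disjnt (cball (fst i) (snd i)) (cball (fst j) (snd j))) C"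
    and neg: "negligible (S - (\<Union>i\<in>C. cball (fst i) (snd i)))"
  proof (rule Vitali_covering_theorem_cballs[of K snd S fst])
    show "0 < snd i" if "i \<in> K" for i using that by (auto simp: K_def)
    fix x and d :: real assume x: "x \<in> S" and "d > 0"
    then obtain r where "r > 0" "cball x r \<subseteq> V" using V(1,2) open_contains_cball by blast
    then have "(x, min r (d/2)) \<in> K" using x \<open>d > 0\<close> by (auto simp: K_def)
    then show "\<exists>i. i \<in> K \<and> x \<in> cball (fst i) (snd i) \<and> snd i < d"
      using \<open>d > 0\<close> \<open>r > 0\<close> by (intro exI[of _ "(x, min r (d/2))"]) auto
  qed blast
  define N where "N = S - (\<Union>i\<in>C. cball (fst i) (snd i))"
  define W where "W = (\<Union>i\<in>C. cball (T (fst i)) (snd i))"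
  have negT: "negligible (T ` N)"
  proof (rule negligible_locally_Lipschitz_image)
    show "negligible N" using neg by (simp add: N_def)
    show "\<exists>A B. open A \<and> x \<in> A \<and> (\<forall>y\<in>N \<inter> A. norm (T y - T x) \<le> B * norm (y - x))" if "x \<in> N" for x
      using T that by (intro exI[of _ UNIV] exI[of _ 1]) (auto simp: N_def dist_norm)
  qed simp
  have bound: "measure lebesgue (\<Union>i\<in>I. cball (T (fst i)) (snd i)) \<le> measure lebesgue V"
    if I: "I \<subseteq> C" "finite I" for I
  proof -
    have "measure lebesgue (\<Union>i\<in>I. cball (T (fst i)) (snd i)) \<le> (\<Sum>i\<in>I. measure lebesgue (cball (T (fst i)) (snd i)))"
      using I by (intro measure_UNION_le) auto
    also have "\<dots> = (\<Sum>i\<in>I. measure lebesgue (cball (fst i) (snd i)))"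
    proof (rule sum.cong[OF refl])
      fix i assume "i \<in> I"
      then have "snd i > 0" using I C by (auto simp: K_def)
      then show "measure lebesgue (cball (T (fst i)) (snd i)) = measure lebesgue (cball (fst i) (snd i))"
        using content_ball_conv_unit_ball[of "snd i" "fst i"] content_ball_conv_unit_ball[of "snd i" "T (fst i)"]
        by (simp add: content_cball_conv_ball)
    qed
    also have "\<dots> = measure lebesgue (\<Union>i\<in>I. cball (fst i) (snd i))"
      using I disj by (intro measure_UNION'[symmetric]) (auto elim: pairwise_mono)
    also have "\<dots> \<le> measure lebesgue V"
    proof (intro measure_mono_fmeasurable Vm)
      show "(\<Union>i\<in>I. cball (fst i) (snd i)) \<subseteq> V"
        using I(1) C(2) unfolding K_def by fastforce
      show "(\<Union>i\<in>I. cball (fst i) (snd i)) \<in> sets lebesgue"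
        using I(2) by (intro sets.finite_UN) auto
    qed
    finally show ?thesis .
  qed
  have W: "W \<in> lmeasurable" "measure lebesgue W \<le> measure lebesgue V"
    unfolding W_def
    by (rule fmeasurable_UN_bound[OF C(1) _ bound] measure_UN_bound[OF C(1) _ bound]; simp)+
  have "Y \<subseteq> W \<union> T ` N"
  proof
    fix y assume "y \<in> Y"
    then obtain x where x: "x \<in> S" "y = T x" using sub by auto
    show "y \<in> W \<union> T ` N"
    proof (cases "x \<in> N")
      case False
      then obtain i where i: "i \<in> C" "x \<in> cball (fst i) (snd i)" using x by (auto simp: N_def)
      then have "fst i \<in> S" using C by (auto simp: K_def)
      from T[OF this x(1)] i x show ?thesis by (force simp: W_def)
    qed (use x in auto)
  qed
  then have "measure lebesgue Y \<le> measure lebesgue (W \<union> T ` N)"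
    using W negT by (intro measure_mono_fmeasurable fmeasurable.Un fmeasurableD[OF Y])
       (auto simp: negligible_imp_measurable)
  also have "\<dots> \<le> measure lebesgue W + measure lebesgue (T ` N)"
    using W negT by (intro measure_Un_le) (auto simp: negligible_imp_measurable fmeasurableD)
  also have "\<dots> \<le> measure lebesgue S + e"
    using W mV negT by (simp add: negligible_imp_measure0)
  finally show "measure lebesgue Y \<le> measure lebesgue S + e" .
qed

text \<open>For \<open>r > 0\<close>, membership of \<open>(x, f x)\<close> in the ball already
  means contact with its boundary, since no graph point is interior to the epigraph.\<close>

definition ball_touched :: "'a::euclidean_space set \<Rightarrow> ('a \<Rightarrow> real) \<Rightarrow> real \<Rightarrow> 'a set" where
  "ball_touched U f r = {x \<in> U. \<exists>c. cball c r \<subseteq> epigraph U f \<and> (x, f x) \<in> cball c r}"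

lemma cball_shrink_about:
  fixes X :: "'a::real_normed_vector"
  assumes "X \<in> cball c r" "0 < r'" "r' \<le> r"
  obtains c' where "X \<in> cball c' r'" "cball c' r' \<subseteq> cball c r"
proof
  define c' where "c' = X + (r' / r) *\<^sub>R (c - X)"
  have r: "r > 0" using assms by simp
  have n: "norm (c - X) \<le> r" using assms by (simp add: dist_norm)
  have "r' / r * norm (c - X) \<le> r' / r * r"
    using n assms r by (intro mult_left_mono) auto
  then show "X \<in> cball c' r'" using assms r by (simp add: c'_def dist_norm)
  have "c - c' = (1 - r' / r) *\<^sub>R (c - X)" by (simp add: c'_def algebra_simps)
  then have "dist c c' = (1 - r' / r) * norm (c - X)" using assms r by (simp add: dist_norm)
  also have "\<dots> \<le> (1 - r' / r) * r" using n assms r by (intro mult_left_mono) auto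
  also have "\<dots> = r - r'" using r by (simp add: field_simps)
  finally have d: "dist c c' + r' \<le> r" by simp
  show "cball c' r' \<subseteq> cball c r"
  proof
    fix y assume "y \<in> cball c' r'"
    then show "y \<in> cball c r" using d dist_triangle[of c y c'] by simp
  qed
qed

lemma ball_touched_antimono:
  assumes "0 < r'" "r' \<le> r"
  shows "ball_touched U f r \<subseteq> ball_touched U f r'"
proof
  fix x assume "x \<in> ball_touched U f r"
  then obtain c where c: "x \<in> U" "cball c r \<subseteq> epigraph U f" "(x, f x) \<in> cball c r"
    by (auto simp: ball_touched_def)
  obtain c' where "(x, f x) \<in> cball c' r'" "cball c' r' \<subseteq> cball c r"
    using cball_shrink_about[OF c(3) assms] .
  then show "x \<in> ball_touched U f r'"
    using c unfolding ball_touched_def by blast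
qed

text \<open>The centre is at distance \<open>r\<close> from \<open>(z, f z)\<close> along the upward
  normal, a multiple of \<open>(- p, 1)\<close>; \<open>b\<close> is its height above the contact
  point. The sphere then curves at least as fast as the paraboloid because
  \<open>2 * b * C \<le> 2 * r * C \<le> 1\<close>.\<close>

lemma ball_touched_of_upper_paraboloid:
  fixes f :: "'a::euclidean_space \<Rightarrow> real"
  assumes r: "r > 0" "2 * r * C \<le> 1" "C \<ge> 0"
    and up: "\<And>h. norm h \<le> 2 * r \<Longrightarrow> z + h \<in> U \<and> f (z + h) \<le> f z + p \<bullet> h + C * (norm h)\<^sup>2"
  shows "z \<in> ball_touched U f r"
proof -
  define m where "m = sqrt (1 + (norm p)\<^sup>2)"
  define b where "b = r / m"
  have "1 \<le> sqrt (1 + (norm p)\<^sup>2)" by (rule real_le_rsqrt) simp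
  then have m: "m \<ge> 1" by (simp add: m_def)
  have m2: "m\<^sup>2 = 1 + (norm p)\<^sup>2" by (simp add: m_def)
  have b: "b > 0" "b \<le> r" using r m mult_left_mono[OF m, of r] by (auto simp: b_def divide_le_eq)
  have b2: "b\<^sup>2 * (1 + (norm p)\<^sup>2) = r\<^sup>2"
    using m by (simp add: b_def power_divide flip: m2)
  have pn: "norm p \<le> m"
    using m by (auto simp: m2 intro: power2_le_imp_le[of "norm p" m])
  have "b * norm p \<le> b * m" using pn b by (intro mult_left_mono) auto
  then have bp: "b * norm p \<le> r" using m by (simp add: b_def)
  define c where "c = (z - b *\<^sub>R p, f z + b)"
  have "z \<in> U" using up[of 0] r by auto
  moreover have "(z, f z) \<in> cball c r"
  proof -
    have "(dist c (z, f z))\<^sup>2 = b\<^sup>2 * (1 + (norm p)\<^sup>2)"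
      using b by (simp add: c_def dist_prod_def dist_norm real_sqrt_pow2 power_mult_distrib algebra_simps)
    then have "(dist c (z, f z))\<^sup>2 \<le> r\<^sup>2" using b2 by simp
    then show ?thesis using r power2_le_imp_le[of "dist c (z, f z)" r] by simp
  qed
  moreover have "cball c r \<subseteq> epigraph U f"
  proof
    fix Y assume Y: "Y \<in> cball c r"
    obtain y s where Yeq: "Y = (y, s)" by (cases Y)
    define h where "h = y - z"
    define \<sigma> where "\<sigma> = s - f z"
    have "(dist Y c)\<^sup>2 \<le> r\<^sup>2" using Y by (intro power_mono) (auto simp: dist_commute)
    also have "(dist Y c)\<^sup>2 = (norm (h + b *\<^sub>R p))\<^sup>2 + (\<sigma> - b)\<^sup>2"
      by (simp add: Yeq c_def dist_prod_def dist_norm real_sqrt_pow2 h_def \<sigma>_def algebra_simps)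
    finally have ineq: "(norm (h + b *\<^sub>R p))\<^sup>2 + (\<sigma> - b)\<^sup>2 \<le> r\<^sup>2" .
    then have "(norm (h + b *\<^sub>R p))\<^sup>2 \<le> r\<^sup>2" by (smt (verit) zero_le_power2)
    then have "norm (h + b *\<^sub>R p) \<le> r" using r power2_le_imp_le[of "norm (h + b *\<^sub>R p)" r] by simp
    then have nh: "norm h \<le> 2 * r"
      using norm_triangle_ineq4[of "h + b *\<^sub>R p" "b *\<^sub>R p"] bp b by simp
    have "(norm (h + b *\<^sub>R p))\<^sup>2 = (norm h)\<^sup>2 + 2 * b * (p \<bullet> h) + b\<^sup>2 * (norm p)\<^sup>2"
      unfolding power2_norm_eq_inner
      by (simp add: inner_add_left inner_add_right inner_commute power2_eq_square algebra_simps)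
    with ineq b2 have "(norm h)\<^sup>2 + 2 * b * (p \<bullet> h) + \<sigma>\<^sup>2 \<le> 2 * b * \<sigma>"
      by (simp add: power2_eq_square algebra_simps)
    then have "(norm h)\<^sup>2 + 2 * b * (p \<bullet> h) \<le> 2 * b * \<sigma>" by (smt (verit) zero_le_power2)
    moreover have "2 * b * C * (norm h)\<^sup>2 \<le> 1 * (norm h)\<^sup>2"
      using b r mult_right_mono[OF b(2) r(3)] by (intro mult_right_mono) auto
    ultimately have "(2 * b) * (p \<bullet> h + C * (norm h)\<^sup>2) \<le> (2 * b) * \<sigma>"
      by (simp add: algebra_simps)
    then have "p \<bullet> h + C * (norm h)\<^sup>2 \<le> \<sigma>" using b by simp
    then show "Y \<in> epigraph U f"
      using up[OF nh] by (simp add: Yeq mem_epigraph h_def \<sigma>_def)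
  qed
  ultimately show ?thesis unfolding ball_touched_def by blast
qed

text \<open>A paraboloid of opening \<open>\<kappa>\<close> centred at \<open>y\<close> touches \<open>f\<close> from above at \<open>z\<close>. As in the
  Baillon--Haddad theorem, the upper bound at one contact point is played against the subgradient
  inequality at the other, at the points \<open>z1 + (b - a)\<close> and \<open>z2 + (a - b)\<close> which minimise the
  difference of the two bounds.\<close>

lemma touching_centres_nonexpansive:
  fixes f :: "'a::euclidean_space \<Rightarrow> real"
  assumes f: "convex_on (cball x0 (2*R)) f" and "R > 0" "\<kappa> > 0"
    and z1: "z1 \<in> cball x0 R" "y1 \<in> cball x0 R" "dist z1 y1 \<le> R"
    and z2: "z2 \<in> cball x0 R" "y2 \<in> cball x0 R" "dist z2 y2 \<le> R"
    and c1: "\<And>w. w \<in> cball x0 (2*R) \<Longrightarrow> f w - \<kappa>/2 * (dist w y1)\<^sup>2 \<le> f z1 - \<kappa>/2 * (dist z1 y1)\<^sup>2"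
    and c2: "\<And>w. w \<in> cball x0 (2*R) \<Longrightarrow> f w - \<kappa>/2 * (dist w y2)\<^sup>2 \<le> f z2 - \<kappa>/2 * (dist z2 y2)\<^sup>2"
  shows "dist y1 y2 \<le> dist z1 z2"
proof -
  have up: "f w \<le> f z + (\<kappa> *\<^sub>R (z - y)) \<bullet> (w - z) + \<kappa>/2 * (norm (w - z))\<^sup>2"
    if "f w - \<kappa>/2 * (dist w y)\<^sup>2 \<le> f z - \<kappa>/2 * (dist z y)\<^sup>2" for z y w
  proof -
    have "(dist w y)\<^sup>2 = (dist z y)\<^sup>2 + 2 * ((z - y) \<bullet> (w - z)) + (norm (w - z))\<^sup>2"
      by (simp add: dist_norm power2_norm_eq_inner inner_diff_left inner_diff_right inner_commute)
    moreover have "f w \<le> f z + \<kappa>/2 * ((dist w y)\<^sup>2 - (dist z y)\<^sup>2)"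
      using that by (simp only: right_diff_distrib)
    ultimately show ?thesis by (simp add: distrib_left)
  qed
  have int: "z \<in> interior (cball x0 (2*R))" if "z \<in> cball x0 R" for z
    using that \<open>R > 0\<close> by simp
  have sub1: "subgradient_on (cball x0 (2*R)) f z1 (\<kappa> *\<^sub>R (z1 - y1))"
    by (rule subgradient_of_upper_paraboloid[OF f int[OF z1(1)] up[OF c1]])
  have sub2: "subgradient_on (cball x0 (2*R)) f z2 (\<kappa> *\<^sub>R (z2 - y2))"
    by (rule subgradient_of_upper_paraboloid[OF f int[OF z2(1)] up[OF c2]])
  define a b d where "a = z1 - y1" and "b = z2 - y2" and "d = z1 - z2"
  have w1: "z1 + (b - a) \<in> cball x0 (2*R)"
    using z1 z2 norm_triangle_ineq4[of "x0 - y1" b]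
    by (simp add: a_def b_def dist_norm algebra_simps)
  have w2: "z2 + (a - b) \<in> cball x0 (2*R)"
    using z1 z2 norm_triangle_ineq4[of "x0 - y2" a]
    by (simp add: a_def b_def dist_norm algebra_simps)
  have "f z2 + \<kappa> * (b \<bullet> (d - a + b)) \<le> f (z1 + (b - a))"
  proof -
    have eq: "z1 + (b - a) - z2 = d - a + b" by (simp add: d_def)
    show ?thesis
      using bspec[OF sub2[unfolded subgradient_on_def] w1] by (simp add: eq flip: b_def)
  qed
  also have "\<dots> \<le> f z1 + \<kappa> * (a \<bullet> (b - a)) + \<kappa>/2 * (norm (b - a))\<^sup>2"
    using up[OF c1[OF w1]] by (simp flip: a_def)
  finally have A: "f z2 + \<kappa> * (b \<bullet> (d - a + b)) \<le> f z1 + \<kappa> * (a \<bullet> (b - a)) + \<kappa>/2 * (norm (b - a))\<^sup>2" .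
  have "f z1 + \<kappa> * (a \<bullet> (- d - b + a)) \<le> f (z2 + (a - b))"
  proof -
    have eq: "z2 + (a - b) - z1 = - d - b + a" by (simp add: d_def)
    show ?thesis
      using bspec[OF sub1[unfolded subgradient_on_def] w2] by (simp add: eq flip: a_def)
  qed
  also have "\<dots> \<le> f z2 + \<kappa> * (b \<bullet> (a - b)) + \<kappa>/2 * (norm (a - b))\<^sup>2"
    using up[OF c2[OF w2]] by (simp flip: b_def)
  finally have B: "f z1 + \<kappa> * (a \<bullet> (- d - b + a)) \<le> f z2 + \<kappa> * (b \<bullet> (a - b)) + \<kappa>/2 * (norm (a - b))\<^sup>2" .
  have "\<kappa> * ((a - b) \<bullet> (a - b)) \<le> \<kappa> * ((a - b) \<bullet> d)"
    using A B
    by (simp add: power2_norm_eq_inner inner_diff_left inner_diff_right inner_add_right inner_commute algebra_simps)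
  then have e: "(a - b) \<bullet> (a - b) \<le> (a - b) \<bullet> d" using \<open>\<kappa> > 0\<close> by simp
  have "y1 - y2 = d - (a - b)" by (simp add: a_def b_def d_def)
  then have "(dist y1 y2)\<^sup>2 = (norm d)\<^sup>2 - 2 * ((a - b) \<bullet> d) + (a - b) \<bullet> (a - b)"
    by (simp add: dist_norm power2_norm_eq_inner inner_diff_left inner_diff_right inner_commute)
  also have "\<dots> \<le> (norm d)\<^sup>2"
    using e inner_ge_zero[of "a - b"] by linarith
  finally have "(dist y1 y2)\<^sup>2 \<le> (dist z1 z2)\<^sup>2" by (simp add: d_def dist_norm)
  then show ?thesis by (rule power2_le_imp_le) simp
qed

text \<open>Quantitative form of the touching argument: losing the width \<open>s\<close> in the
  radius of the ball of centres buys a fixed opening \<kappa>, and with it a fixed radius of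
  interior balls.\<close>

lemma large_compact_ball_touched:
  fixes f :: "'a::euclidean_space \<Rightarrow> real"
  assumes f: "convex_on (cball x0 (2*R)) f" and U: "cball x0 (2*R) \<subseteq> U"
    and lip: "\<And>x y. x \<in> cball x0 (2*R) \<Longrightarrow> y \<in> cball x0 (2*R) \<Longrightarrow> \<bar>f x - f y\<bar> \<le> L * dist x y"
    and L: "L > 0" and s: "0 < s" "s \<le> R"
  obtains K r where "compact K" "r > 0" "K \<subseteq> cball x0 R" "K \<subseteq> ball_touched U f r"
    "measure lebesgue (ball x0 (R - s)) \<le> measure lebesgue K"
proof -
  define \<kappa> where "\<kappa> = 2 * L / s"
  have "\<kappa> > 0" using L s by (simp add: \<kappa>_def)
  have "R > 0" using s by simp
  have cont: "continuous_on (cball x0 (2*R)) f"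
    using L by (intro lipschitz_on_continuous_on[of L] lipschitz_onI) (auto simp: dist_norm lip[unfolded dist_norm])
  \<comment> \<open>Maximality is required on radius \<open>2 * R\<close> but \<open>z\<close> and
    \<open>y\<close> stay within radius \<open>R\<close>, so that the auxiliary points of the
    contraction estimate remain in the domain.\<close>
  define touch where "touch z y \<longleftrightarrow> z \<in> cball x0 R \<and> y \<in> cball x0 R \<and> dist z y \<le> R \<and>
    (\<forall>w\<in>cball x0 (2*R). f w - \<kappa>/2 * (dist w y)\<^sup>2 \<le> f z - \<kappa>/2 * (dist z y)\<^sup>2)" for z y
  have contract: "dist y1 y2 \<le> dist z1 z2" if "touch z1 y1" "touch z2 y2" for z1 z2 y1 y2
    using touching_centres_nonexpansive[OF f \<open>R > 0\<close> \<open>\<kappa> > 0\<close>] that unfolding touch_def by blast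
  define K where "K = {z. \<exists>y. touch z y}"
  define T where "T z = (SOME y. touch z y)" for z
  have T: "touch z (T z)" if "z \<in> K" for z
    using that unfolding K_def T_def by (auto intro: someI)
  have "compact K"
  proof -
    let ?D = "cball x0 R \<times> cball x0 R"
    have c: "continuous_on ?D (\<lambda>q. f (fst q))"
      using \<open>R > 0\<close> by (intro continuous_on_compose2[OF cont]) (auto intro!: continuous_intros)
    have "{q. touch (fst q) (snd q)} = ?D \<inter> {q\<in>?D. dist (fst q) (snd q) \<le> R} \<inter>
       (\<Inter>w\<in>cball x0 (2*R). {q\<in>?D. f w - \<kappa>/2 * (dist w (snd q))\<^sup>2 \<le> f (fst q) - \<kappa>/2 * (dist (fst q) (snd q))\<^sup>2})"
      using \<open>R > 0\<close> by (auto simp: touch_def mem_Times_iff simp del: mem_cball)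
    moreover have "compact \<dots>"
      by (intro compact_Int_closed compact_Times compact_cball closed_INT ballI
          continuous_on_closed_Collect_le closed_Times closed_cball continuous_intros c)
    ultimately have "compact (fst ` {q. touch (fst q) (snd q)})"
      by (auto intro!: compact_continuous_image continuous_intros)
    moreover have "fst ` {q. touch (fst q) (snd q)} = K" unfolding K_def by (auto simp: image_iff)
    ultimately show ?thesis by simp
  qed
  \<comment> \<open>Every centre \<open>y\<close> has a contact point, so \<open>K\<close> is at least as large as the set of centres.\<close>
  have "ball x0 (R - s) \<subseteq> T ` K"
  proof
    fix y assume y: "y \<in> ball x0 (R - s)"
    have "continuous_on (cball x0 (2*R)) (\<lambda>w. f w - \<kappa>/2 * (dist w y)\<^sup>2)"
      by (intro continuous_intros cont)
    then have "\<exists>z\<in>cball x0 (2*R). \<forall>w\<in>cball x0 (2*R). f w - \<kappa>/2 * (dist w y)\<^sup>2 \<le> f z - \<kappa>/2 * (dist z y)\<^sup>2"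
      using \<open>R > 0\<close> by (intro continuous_attains_sup) auto
    then obtain z where z: "z \<in> cball x0 (2*R)"
      and max: "\<And>w. w \<in> cball x0 (2*R) \<Longrightarrow> f w - \<kappa>/2 * (dist w y)\<^sup>2 \<le> f z - \<kappa>/2 * (dist z y)\<^sup>2"
      by blast
    have yR: "y \<in> cball x0 (2*R)" using y s by auto
    have "\<kappa>/2 * (dist z y)\<^sup>2 \<le> f z - f y" using max[OF yR] by simp
    also have "\<dots> \<le> L * dist z y" using lip[OF z yR] by simp
    finally have "dist z y * (L / s * dist z y) \<le> dist z y * L"
      by (simp add: \<kappa>_def power2_eq_square mult_ac)
    then have dzy: "dist z y \<le> s"
      using L s by (cases "z = y") (auto simp: field_simps)
    have "touch z y"
      using y s dzy max dist_triangle[of x0 z y] by (auto simp: touch_def dist_commute)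
    then have "z \<in> K" by (auto simp: K_def)
    \<comment> \<open>Contraction at equal contact points says that a contact point determines its
      centre, so the chosen \<open>T z\<close> is \<open>y\<close>.\<close>
    then have "dist y (T z) \<le> dist z z" using contract \<open>touch z y\<close> T by blast
    then show "y \<in> T ` K" using \<open>z \<in> K\<close> by auto
  qed
  then have meas: "measure lebesgue (ball x0 (R - s)) \<le> measure lebesgue K"
    using contract T \<open>compact K\<close> by (intro measure_le_of_nonexpansive_image[of _ _ T]) (auto intro: lmeasurable_compact)
  \<comment> \<open>The paraboloid has \<open>C = \<kappa>/2\<close>, so
    \<open>2 * r * C \<le> 1\<close> means \<open>r * \<kappa> \<le> 1\<close>; the bound
    \<open>R / 2\<close> keeps displacements up to \<open>2 * r\<close> inside the large
    ball.\<close>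
  define r where "r = min (1 / \<kappa>) (R / 2)"
  have r: "r > 0" "2 * r \<le> R" "r * \<kappa> \<le> 1"
    using \<open>\<kappa> > 0\<close> \<open>R > 0\<close> by (auto simp: r_def min_def field_simps)
  have "K \<subseteq> ball_touched U f r"
  proof
    fix z assume "z \<in> K"
    then have t: "touch z (T z)" by (rule T)
    show "z \<in> ball_touched U f r"
    proof (rule ball_touched_of_upper_paraboloid)
      fix h :: 'a assume "norm h \<le> 2 * r"
      then have w: "z + h \<in> cball x0 (2*R)"
        using t r norm_triangle_ineq4[of "x0 - z" h] by (simp add: touch_def dist_norm algebra_simps)
      have "f (z + h) \<le> f z + (\<kappa> *\<^sub>R (z - T z)) \<bullet> h + \<kappa>/2 * (norm h)\<^sup>2"
      proof -
        have "(dist (z + h) (T z))\<^sup>2 = (dist z (T z))\<^sup>2 + 2 * ((z - T z) \<bullet> h) + (norm h)\<^sup>2"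
          by (simp add: dist_norm power2_norm_eq_inner inner_diff_left inner_diff_right inner_add_left inner_add_right inner_commute)
        moreover
        have "f (z + h) - \<kappa>/2 * (dist (z + h) (T z))\<^sup>2 \<le> f z - \<kappa>/2 * (dist z (T z))\<^sup>2"
          using t w by (auto simp: touch_def)
        then have "f (z + h) \<le> f z + \<kappa>/2 * ((dist (z + h) (T z))\<^sup>2 - (dist z (T z))\<^sup>2)"
          by (simp only: right_diff_distrib)
        ultimately show ?thesis by (simp add: distrib_left)
      qed
      then show "z + h \<in> U \<and> f (z + h) \<le> f z + (\<kappa> *\<^sub>R (z - T z)) \<bullet> h + \<kappa>/2 * (norm h)\<^sup>2"
        using w U by auto
    qed (use r \<open>\<kappa> > 0\<close> in auto)
  qed
  moreover have "K \<subseteq> cball x0 R" by (auto simp: K_def touch_def)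
  ultimately show thesis
    using that \<open>compact K\<close> r(1) meas by blast
qed

text \<open>As the width \<open>s\<close> tends to 0, the part of \<open>cball x0 R\<close> outside
  the compact touched set has arbitrarily small measure. The radius of the touching balls may
  deteriorate on the way; the union over \<open>n\<close> absorbs this.\<close>

lemma negligible_not_ball_touched:
  fixes f :: "'a::euclidean_space \<Rightarrow> real"
  assumes U: "open U" and f: "convex_on U f"
  shows "negligible (U - (\<Union>n. ball_touched U f (1 / real (Suc n))))" (is "negligible ?N")
  unfolding locally_negligible_alt[of ?N]
proof
  fix x0 assume "x0 \<in> ?N"
  then have "x0 \<in> U" by simp
  obtain R0 L where R0: "R0 > 0" "L > 0" "cball x0 R0 \<subseteq> U"
    and lip: "\<forall>x\<in>cball x0 R0. \<forall>y\<in>cball x0 R0. \<bar>f x - f y\<bar> \<le> L * dist x y"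
    by (rule convex_on_locally_bounded_subgradient[OF U f \<open>x0 \<in> U\<close>]) (rule that)
  define R where "R = R0 / 2"
  have "R > 0" and R: "2 * R = R0" using R0 by (auto simp: R_def)
  have fR: "convex_on (cball x0 (2*R)) f"
    using f R0 by (auto simp: R intro: convex_on_subset)
  have "negligible (?N \<inter> cball x0 R)"
    unfolding negligible_outer_le
  proof (intro allI impI)
    fix e :: real assume "e > 0"
    have "((\<lambda>s. (R - s) ^ DIM('a) * measure lborel (ball (0::'a) 1)) \<longlongrightarrow> (R - 0) ^ DIM('a) * measure lborel (ball (0::'a) 1)) (at_right 0)"
      by (intro tendsto_intros)
    then have "\<forall>\<^sub>F s in at_right 0. (R - s) ^ DIM('a) * measure lborel (ball (0::'a) 1) > R ^ DIM('a) * measure lborel (ball (0::'a) 1) - e"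
      by (rule order_tendstoD) (use \<open>e > 0\<close> in simp)
    moreover have "\<forall>\<^sub>F s in at_right 0. 0 < s \<and> s < R"
      using \<open>R > 0\<close> by (auto simp: eventually_at_right_field)
    ultimately have "\<forall>\<^sub>F s in at_right 0. (0 < s \<and> s < R) \<and>
        (R - s) ^ DIM('a) * measure lborel (ball (0::'a) 1) > R ^ DIM('a) * measure lborel (ball (0::'a) 1) - e"
      by eventually_elim auto
    then obtain s where s: "0 < s" "s < R" and
      "(R - s) ^ DIM('a) * measure lborel (ball (0::'a) 1) > R ^ DIM('a) * measure lborel (ball (0::'a) 1) - e"
      using eventually_happens'[OF trivial_limit_at_right_real] by blast
    then have cs: "measure lebesgue (cball x0 R) - e < measure lebesgue (ball x0 (R - s))"
      using content_ball_conv_unit_ball[of R x0] content_ball_conv_unit_ball[of "R - s" x0] \<open>R > 0\<close>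
      by (simp add: content_cball_conv_ball)
    obtain K r where K: "compact K" "r > 0" "K \<subseteq> cball x0 R" "K \<subseteq> ball_touched U f r"
       and mK: "measure lebesgue (ball x0 (R - s)) \<le> measure lebesgue K"
      using large_compact_ball_touched[OF fR, of U L s] lip R0 s by (auto simp: R simp del: mem_cball)
    obtain n where "1 / real (Suc n) < r" using nat_approx_posE[OF \<open>r > 0\<close>] by blast
    then have "K \<subseteq> ball_touched U f (1 / real (Suc n))"
      using K(4) ball_touched_antimono[of "1 / real (Suc n)" r U f] by force
    then have "?N \<inter> cball x0 R \<subseteq> cball x0 R - K" by blast
    moreover have "measure lebesgue (cball x0 R - K) \<le> e"
      using cs mK K lmeasurable_compact[OF K(1)]
      by (subst measurable_measure_Diff) (auto simp: fmeasurableD)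
    moreover have "cball x0 R - K \<in> lmeasurable"
      using lmeasurable_compact[OF K(1)] by (intro fmeasurable.Diff) auto
    ultimately show "\<exists>T. ?N \<inter> cball x0 R \<subseteq> T \<and> T \<in> lmeasurable \<and> measure lebesgue T \<le> e" by blast
  qed
  then have "negligible (?N \<inter> ball x0 R)"
    by (rule negligible_subset) auto
  then show "\<exists>V. openin (top_of_set ?N) V \<and> x0 \<in> V \<and> negligible V"
    using \<open>x0 \<in> ?N\<close> \<open>R > 0\<close> by (intro exI[of _ "?N \<inter> ball x0 R"]) (auto intro: openin_open_Int)
qed

section \<open>Unions of balls of height-dependent radius\<close>

text \<open>Closed in the whole space although \<open>U\<close> is open: heights along a convergent
  sequence are bounded, so the base points stay in one compact sublevel set and cannot reach the
  boundary of \<open>U\<close>.\<close>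

lemma closed_epigraph:
  fixes f :: "'a::euclidean_space \<Rightarrow> real"
  assumes cont: "continuous_on U f" and comp: "\<And>c. compact {x\<in>U. f x \<le> c}"
  shows "closed (epigraph U f)"
  unfolding closed_sequential_limits
proof (intro allI impI, elim conjE)
  fix X l assume X: "\<forall>n. X n \<in> epigraph U f" and lim: "X \<longlonglongrightarrow> l"
  have l1: "(\<lambda>n. fst (X n)) \<longlonglongrightarrow> fst l" and l2: "(\<lambda>n. snd (X n)) \<longlonglongrightarrow> snd l"
    using lim by (auto intro: tendsto_intros)
  have "Bseq (\<lambda>n. snd (X n))" using l2 by (auto intro: convergent_imp_Bseq convergentI)
  then obtain c where c: "\<And>n. \<bar>snd (X n)\<bar> \<le> c" by (auto simp: Bseq_def)
  have K: "fst (X n) \<in> {x\<in>U. f x \<le> c}" for n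
    using X c[of n] by (auto simp: epigraph_def intro: order_trans)
  then have "fst l \<in> {x\<in>U. f x \<le> c}"
    using closed_sequentially[OF compact_imp_closed[OF comp] _ l1] by blast
  then have lU: "fst l \<in> U" by simp
  have "(\<lambda>n. f (fst (X n))) \<longlonglongrightarrow> f (fst l)"
    using cont l1 lU K unfolding continuous_on_sequentially by (auto simp: o_def)
  then have "f (fst l) \<le> snd l"
    using X by (intro LIMSEQ_le[OF _ l2]) (auto simp: epigraph_def)
  then show "l \<in> epigraph U f" using lU by (simp add: epigraph_def)
qed

text \<open>The centres of balls of radius \<open>r\<close> inside the epigraph form a closed set
  \<open>E\<close>, an intersection of translates. Their union \<open>D\<close> is closed as the sum
  of a closed and a compact set, and the touched points are its preimage under the graph
  map.\<close>

lemma ball_touched_measurable: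
  fixes f :: "'a::euclidean_space \<Rightarrow> real"
  assumes U: "open U" and cont: "continuous_on U f" and cl: "closed (epigraph U f)"
  shows "ball_touched U f r \<in> sets borel"
proof -
  define E where "E = {c. cball c r \<subseteq> epigraph U f}"
  define D where "D = (\<Union>c\<in>E. \<Union>v\<in>cball 0 r. {c + v})"
  have "E = (\<Inter>v\<in>cball 0 r. (\<lambda>c. c + v) -` epigraph U f)"
  proof (intro equalityI subsetI)
    fix c assume "c \<in> E"
    then show "c \<in> (\<Inter>v\<in>cball 0 r. (\<lambda>c. c + v) -` epigraph U f)"
      by (auto simp: E_def subset_iff dist_norm simp del: split_paired_All)
  next
    fix c assume c: "c \<in> (\<Inter>v\<in>cball 0 r. (\<lambda>c. c + v) -` epigraph U f)"
    show "c \<in> E"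
      unfolding E_def
    proof (intro CollectI subsetI)
      fix y assume "y \<in> cball c r"
      then have "y - c \<in> cball 0 r" by (simp add: dist_norm norm_minus_commute)
      then have "c + (y - c) \<in> epigraph U f" using c by blast
      then show "y \<in> epigraph U f" by simp
    qed
  qed
  moreover have "closed \<dots>"
    using cl by (intro closed_INT ballI closed_vimage continuous_intros)
  ultimately have "closed E" by simp
  then have "closed D" unfolding D_def by (intro closed_compact_sums compact_cball)
  have "X \<in> D \<longleftrightarrow> (\<exists>c\<in>E. X \<in> cball c r)" for X
  proof
    assume "\<exists>c\<in>E. X \<in> cball c r"
    then obtain c where "c \<in> E" "X - c \<in> cball 0 r" by (auto simp: dist_norm norm_minus_commute)
    then show "X \<in> D" unfolding D_def by (intro UN_I[of c] UN_I[of "X - c"]) auto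
  next
    assume "X \<in> D"
    then obtain c v where "c \<in> E" "v \<in> cball 0 r" "X = c + v" by (auto simp: D_def)
    then show "\<exists>c\<in>E. X \<in> cball c r" by (intro bexI[of _ c]) (simp_all add: dist_norm)
  qed
  then have "ball_touched U f r = U \<inter> (\<lambda>x. (x, f x)) -` D"
    unfolding ball_touched_def E_def by blast
  moreover have "closedin (top_of_set U) (U \<inter> (\<lambda>x. (x, f x)) -` D)"
    using \<open>closed D\<close> by (intro continuous_closedin_preimage continuous_intros cont)
  ultimately show ?thesis
    using U by (auto simp: closedin_closed)
qed

section \<open>Choice of a radius for each height\<close>

lemma emeasure_UN_less:
  assumes A: "range A \<subseteq> sets M" and \<epsilon>: "\<epsilon> > 0"
    and le: "\<And>j. emeasure M (A j) \<le> ennreal (\<epsilon> / 2 ^ (j + 2))"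
  shows "emeasure M (\<Union>j. A j) < ennreal \<epsilon>"
proof -
  \<comment> \<open>The shares \<open>\<epsilon> / 2 ^ (j + 2)\<close> add up to
    \<open>\<epsilon> / 2\<close> only, which makes the final inequality strict.\<close>
  have s: "(\<lambda>j. \<epsilon> / 4 * (1/2) ^ j) sums (\<epsilon> / 4 * (1 / (1 - 1/2)))"
    by (intro sums_mult geometric_sums) simp
  have eq: "\<epsilon> / 2 ^ (j + 2) = \<epsilon> / 4 * (1/2) ^ j" for j by (simp add: power_divide)
  have "emeasure M (\<Union>j. A j) \<le> (\<Sum>j. emeasure M (A j))"
    using A by (rule emeasure_subadditive_countably)
  also have "\<dots> \<le> (\<Sum>j. ennreal (\<epsilon> / 4 * (1/2) ^ j))"
    using le unfolding eq by (intro suminf_le) auto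
  also have "\<dots> = ennreal (\<epsilon> / 2)"
    using \<epsilon> s by (subst suminf_ennreal2) (auto simp: sums_iff)
  also have "\<dots> < ennreal \<epsilon>" using \<epsilon> by (simp add: ennreal_less_iff)
  finally show ?thesis .
qed

lemma decseq_emeasure_small:
  assumes A: "\<And>n. A n \<in> lmeasurable" and "decseq A" and neg: "negligible (\<Inter>n. A n)" and "e > 0"
  obtains n where "emeasure lebesgue (A n) \<le> ennreal e"
proof -
  have "(\<lambda>n. measure lebesgue (A n)) \<longlonglongrightarrow> measure lebesgue (\<Inter>n. A n)"
  proof (rule Lim_measure_decseq)
    show "emeasure lebesgue (A n) \<noteq> \<infinity>" for n
      using fmeasurableD2[OF A[of n]] by simp
  qed (use A \<open>decseq A\<close> in \<open>auto simp: fmeasurableD\<close>)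
  then have "(\<lambda>n. measure lebesgue (A n)) \<longlonglongrightarrow> 0"
    using neg by (simp add: negligible_imp_measure0)
  then have "\<forall>\<^sub>F n in sequentially. measure lebesgue (A n) < e"
    using \<open>e > 0\<close> by (rule order_tendstoD)
  then obtain n where "measure lebesgue (A n) < e"
    using eventually_happens'[OF sequentially_bot] by blast
  then show thesis
    using A[of n] by (intro that[of n]) (simp add: emeasure_eq_measure2 ennreal_leI)
qed

text \<open>Level \<open>j + 1\<close> goes with the radius \<open>r j\<close> because
  \<open>r j\<close> has to serve the points with
  \<open>real j \<le> f x \<le> real j + 1\<close>.\<close>

lemma touching_radii:
  fixes f :: "'a::euclidean_space \<Rightarrow> real"
  assumes U: "open U" and f: "convex_on U f" and comp: "\<And>c. compact {x\<in>U. f x \<le> c}" and "\<epsilon> > 0"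
  obtains r :: "nat \<Rightarrow> real" where "\<forall>j. 0 < r j" "\<forall>j. r j \<le> 1 / (real j + 1)" "antimono r"
    "emeasure lebesgue (\<Union>j. {x\<in>U. f x \<le> real j + 1} - ball_touched U f (r j)) < ennreal \<epsilon>"
    "range (\<lambda>j. {x\<in>U. f x \<le> real j + 1} - ball_touched U f (r j)) \<subseteq> sets lebesgue"
proof -
  have cont: "continuous_on U f" using convex_on_continuous[OF U f] .
  have T: "ball_touched U f s \<in> sets lebesgue" for s
    using ball_touched_measurable[OF U cont closed_epigraph[OF cont comp]] by simp
  define K where "K j = {x\<in>U. f x \<le> real j + 1}" for j :: nat
  have K: "K j \<in> lmeasurable" for j using comp by (simp add: K_def lmeasurable_compact)
  have "\<exists>n. emeasure lebesgue (K j - ball_touched U f (1 / real (Suc n))) \<le> ennreal (\<epsilon> / 2 ^ (j + 2))" for j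
  proof (rule decseq_emeasure_small[of "\<lambda>n. K j - ball_touched U f (1 / real (Suc n))" "\<epsilon> / 2 ^ (j + 2)"])
    show "K j - ball_touched U f (1 / real (Suc n)) \<in> lmeasurable" for n
      by (rule fmeasurable_Diff[OF K T])
    show "decseq (\<lambda>n. K j - ball_touched U f (1 / real (Suc n)))"
    proof (rule decseq_SucI)
      fix n
      have "ball_touched U f (1 / real (Suc n)) \<subseteq> ball_touched U f (1 / real (Suc (Suc n)))"
        by (rule ball_touched_antimono) (auto simp: field_simps)
      then show "K j - ball_touched U f (1 / real (Suc (Suc n))) \<subseteq> K j - ball_touched U f (1 / real (Suc n))"
        by blast
    qed
    show "negligible (\<Inter>n. K j - ball_touched U f (1 / real (Suc n)))"
      by (rule negligible_subset[OF negligible_not_ball_touched[OF U f]]) (auto simp: K_def)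
  qed (use \<open>\<epsilon> > 0\<close> in auto)
  then obtain n where n: "\<And>j. emeasure lebesgue (K j - ball_touched U f (1 / real (Suc (n j)))) \<le> ennreal (\<epsilon> / 2 ^ (j + 2))"
    by metis
  \<comment> \<open>The partial sums make \<open>r\<close> decreasing, and the summand
    \<open>j\<close> gives \<open>r j \<le> 1 / (real j + 1)\<close>. Shrinking a radius only
    enlarges the touched set.\<close>
  define N where "N j = j + (\<Sum>i\<le>j. n i)" for j
  define r where "r j = 1 / real (Suc (N j))" for j
  have Nmono: "N i \<le> N j" if "i \<le> j" for i j
    using that by (auto simp: N_def intro!: add_mono sum_mono2)
  have nN: "n j \<le> N j" for j
    by (simp add: N_def member_le_sum trans_le_add2)
  show thesis
  proof
    show "\<forall>j. 0 < r j" by (simp add: r_def)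
    show "\<forall>j. r j \<le> 1 / (real j + 1)" by (auto simp: r_def N_def intro!: frac_le sum_nonneg)
    show "antimono r" using Nmono by (auto simp: antimono_def r_def field_simps)
    show sets: "range (\<lambda>j. {x\<in>U. f x \<le> real j + 1} - ball_touched U f (r j)) \<subseteq> sets lebesgue"
      using T K by (fastforce simp flip: K_def simp: fmeasurableD)
    show "emeasure lebesgue (\<Union>j. {x\<in>U. f x \<le> real j + 1} - ball_touched U f (r j)) < ennreal \<epsilon>"
    proof (rule emeasure_UN_less[OF sets \<open>\<epsilon> > 0\<close>])
      fix j
      have "ball_touched U f (1 / real (Suc (n j))) \<subseteq> ball_touched U f (r j)"
        using nN[of j] by (intro ball_touched_antimono) (auto simp: r_def field_simps)
      then have "emeasure lebesgue (K j - ball_touched U f (r j)) \<le> emeasure lebesgue (K j - ball_touched U f (1 / real (Suc (n j))))"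
        using T K by (intro emeasure_mono) (auto simp: fmeasurableD)
      also note n
      finally show "emeasure lebesgue ({x\<in>U. f x \<le> real j + 1} - ball_touched U f (r j)) \<le> ennreal (\<epsilon> / 2 ^ (j + 2))"
        by (simp add: K_def)
    qed
  qed
qed

text \<open>A supporting hyperplane at the contact point must be tangent to the ball, which fixes
  the centre. The part of the ball near the contact point then yields the paraboloid;
  \<open>C\<close> depends only on the slope bound and the radius.\<close>

lemma upper_paraboloid_of_touching_ball:
  fixes G :: "'a::euclidean_space \<Rightarrow> real"
  assumes p: "subgradient_on U G x p" "norm p \<le> L" and "\<rho> > 0"
    and ball: "cball c \<rho> \<subseteq> epigraph U G" "(x, G x) \<in> cball c \<rho>"
    and C: "C = (1 + (L + 1)\<^sup>2) * sqrt (1 + L\<^sup>2) / (2 * \<rho>)"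
    and h: "C * norm h \<le> 1"
  shows "x + h \<in> U \<and> G (x + h) \<le> G x + p \<bullet> h + C * (norm h)\<^sup>2"
proof -
  have "L \<ge> 0" using p(2) norm_ge_zero order_trans by blast
  define m where "m = sqrt (1 + (norm p)\<^sup>2)"
  have m2: "m\<^sup>2 = 1 + (norm p)\<^sup>2" by (simp add: m_def)
  have "1 \<le> sqrt (1 + (norm p)\<^sup>2)" by (rule real_le_rsqrt) simp
  then have m: "m \<ge> 1" by (simp add: m_def)
  define b where "b = \<rho> / m"
  have "b > 0" using m \<open>\<rho> > 0\<close> by (simp add: b_def)
  have bm: "b * m = \<rho>" using m by (simp add: b_def)
  then have b2: "b\<^sup>2 * (1 + (norm p)\<^sup>2) = \<rho>\<^sup>2" by (metis m2 power_mult_distrib)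
  define a \<beta> where "a = fst c - x" and "\<beta> = snd c - G x"
  have ceq: "c = (x + a, G x + \<beta>)" by (simp add: a_def \<beta>_def)
  have ab: "(norm a)\<^sup>2 + \<beta>\<^sup>2 \<le> \<rho>\<^sup>2"
  proof -
    have "(dist c (x, G x))\<^sup>2 \<le> \<rho>\<^sup>2" using ball(2) by (intro power_mono) auto
    then show ?thesis by (simp add: ceq dist_prod_def dist_norm)
  qed
  \<comment> \<open>This is the point of the ball farthest in the direction \<open>(p, - 1)\<close>.
    Since it still lies above the supporting hyperplane, while the contact point is within \<rho> of
    \<open>c\<close>, the offset of \<open>c\<close> can only be
    \<open>(- (b *\<^sub>R p), b)\<close>.\<close>
  have "c + (b *\<^sub>R p, - b) \<in> cball c \<rho>"
  proof -
    have "(norm (b *\<^sub>R p, - b))\<^sup>2 = \<rho>\<^sup>2"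
      using b2 by (simp add: norm_prod_def power_mult_distrib algebra_simps)
    then have "norm (b *\<^sub>R p, - b) = \<rho>"
      using \<open>\<rho> > 0\<close> by (simp only: power2_eq_iff_nonneg norm_ge_zero less_imp_le)
    moreover have "dist c (c + (b *\<^sub>R p, - b)) = norm (b *\<^sub>R p, - b)"
      by (metis add_diff_cancel_left' dist_commute dist_norm)
    ultimately show ?thesis by (simp only: mem_cball)
  qed
  then have "c + (b *\<^sub>R p, - b) \<in> epigraph U G" using ball(1) by blast
  then have "x + (a + b *\<^sub>R p) \<in> U" "G (x + (a + b *\<^sub>R p)) \<le> G x + \<beta> - b"
    by (auto simp: ceq mem_epigraph add.assoc)
  then have "p \<bullet> (a + b *\<^sub>R p) \<le> \<beta> - b"
    using p(1) by (fastforce simp: subgradient_on_def)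
  then have "p \<bullet> a + b * (norm p)\<^sup>2 + b \<le> \<beta>"
    by (simp add: inner_add_right power2_norm_eq_inner)
  then have "b * (p \<bullet> a + b * (norm p)\<^sup>2 + b) \<le> b * \<beta>" using \<open>b > 0\<close> by simp
  then have lower: "\<rho>\<^sup>2 \<le> b * \<beta> - b * (p \<bullet> a)"
    unfolding b2[symmetric] by (simp add: algebra_simps power2_eq_square)
  have "(norm (a + b *\<^sub>R p))\<^sup>2 + (\<beta> - b)\<^sup>2 = (norm a)\<^sup>2 + \<beta>\<^sup>2 - 2 * (b * \<beta> - b * (p \<bullet> a)) + b\<^sup>2 * (1 + (norm p)\<^sup>2)"
    unfolding power2_norm_eq_inner
    by (simp add: inner_add_left inner_add_right inner_commute power2_eq_square algebra_simps)
  also have "\<dots> \<le> 0" using ab lower b2 by simp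
  finally have "(norm (a + b *\<^sub>R p))\<^sup>2 + (\<beta> - b)\<^sup>2 \<le> 0" .
  then have "a + b *\<^sub>R p = 0" "\<beta> = b"
    by (auto simp: sum_power2_le_zero_iff)
  then have a: "a = - (b *\<^sub>R p)" by (simp add: add_eq_0_iff2)
  \<comment> \<open>The height of the paraboloid over \<open>x + h\<close>. As
    \<open>C * norm h \<le> 1\<close>, it is at most \<open>(L + 1) * norm h\<close> in modulus;
    this produces the factor \<open>1 + (L + 1)\<^sup>2\<close> of \<open>C\<close>, and the square
    root comes from \<open>b = \<rho> / m\<close>.\<close>
  define \<sigma> where "\<sigma> = p \<bullet> h + C * (norm h)\<^sup>2"
  have "C \<ge> 0" using \<open>\<rho> > 0\<close> by (simp add: C)
  have "\<bar>\<sigma>\<bar> \<le> norm p * norm h + C * norm h * norm h"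
    using Cauchy_Schwarz_ineq2[of p h] \<open>C \<ge> 0\<close> by (simp add: \<sigma>_def power2_eq_square abs_le_iff)
       (smt (verit) mult_nonneg_nonneg norm_ge_zero)
  also have "\<dots> \<le> L * norm h + 1 * norm h"
    using p(2) h by (intro add_mono mult_right_mono) auto
  finally have \<sigma>: "\<bar>\<sigma>\<bar> \<le> \<bar>(L + 1) * norm h\<bar>" using \<open>L \<ge> 0\<close> by (simp add: algebra_simps)
  have \<sigma>2: "\<sigma>\<^sup>2 \<le> (L + 1)\<^sup>2 * (norm h)\<^sup>2"
    using power2_le_iff_abs_le[of "(L+1) * norm h" \<sigma>] \<sigma> \<open>L \<ge> 0\<close> by (simp add: power_mult_distrib)
  have "m \<le> sqrt (1 + L\<^sup>2)"
    unfolding m_def using p(2) by (intro real_sqrt_le_mono add_left_mono power_mono) auto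
  then have "b * sqrt (1 + L\<^sup>2) \<ge> \<rho>" using bm \<open>b > 0\<close> by (metis mult_left_mono less_imp_le)
  then have "(1 + (L+1)\<^sup>2) * \<rho> \<le> (1 + (L+1)\<^sup>2) * (b * sqrt (1 + L\<^sup>2))"
    by (intro mult_left_mono) auto
  then have bC: "1 + (L + 1)\<^sup>2 \<le> 2 * b * C"
    using \<open>\<rho> > 0\<close> by (simp add: C field_simps)
  have "(x + h, G x + \<sigma>) \<in> cball c \<rho>"
  proof -
    have "(dist c (x + h, G x + \<sigma>))\<^sup>2 = (norm (h + b *\<^sub>R p))\<^sup>2 + (\<sigma> - b)\<^sup>2"
      using norm_minus_cancel[of "h + b *\<^sub>R p"]
      by (simp add: ceq a \<open>\<beta> = b\<close> dist_prod_def dist_norm power2_commute algebra_simps)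
    also have "\<dots> = (norm h)\<^sup>2 + \<sigma>\<^sup>2 + 2 * b * (p \<bullet> h - \<sigma>) + b\<^sup>2 * (1 + (norm p)\<^sup>2)"
      unfolding power2_norm_eq_inner
      by (simp add: inner_add_left inner_add_right inner_commute power2_eq_square algebra_simps)
    also have "\<dots> = (norm h)\<^sup>2 + \<sigma>\<^sup>2 - 2 * b * C * (norm h)\<^sup>2 + \<rho>\<^sup>2"
      unfolding b2 by (simp add: \<sigma>_def algebra_simps)
    also have "\<dots> \<le> \<rho>\<^sup>2"
      using mult_right_mono[OF bC, of "(norm h)\<^sup>2"] \<sigma>2 by (simp add: algebra_simps)
    finally have "dist c (x + h, G x + \<sigma>) \<le> \<rho>"
      by (rule power2_le_imp_le) (use \<open>\<rho> > 0\<close> in simp)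
    then show ?thesis by simp
  qed
  then have "(x + h, G x + \<sigma>) \<in> epigraph U G" using ball(1) by blast
  then show ?thesis by (simp add: mem_epigraph \<sigma>_def)
qed

declare split_paired_All[simp del] split_paired_Ex[simp del]

section \<open>Smoothing a convex function with compact sublevel sets\<close>

locale ball_smoothing =
  fixes U :: "'a::euclidean_space set" and f :: "'a \<Rightarrow> real" and r :: "nat \<Rightarrow> real"
  assumes U: "open U" and f: "convex_on U f" and nonneg: "\<And>x. x \<in> U \<Longrightarrow> 0 \<le> f x"
    and comp: "\<And>c. compact {x\<in>U. f x \<le> c}"
    and r_pos: "\<And>j. 0 < r j" and r_le: "\<And>j. r j \<le> 1 / (real j + 1)" and r_mono: "antimono r"
begin

text \<open>The radius is bounded below by affine functions of the height of the centre. This keeps the set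
  of admissible pairs convex, gives a uniform radius at bounded height, and still allows the radius
  \<open>r j\<close> for centres above height \<open>j\<close>.\<close>

definition admissible :: "'a \<times> real \<Rightarrow> real \<Rightarrow> bool" where
  "admissible c \<rho> \<longleftrightarrow> 0 < \<rho> \<and> cball c \<rho> \<subseteq> epigraph U f \<and> (\<forall>k. r k * (1 - snd c / (real k + 1)) \<le> \<rho>)"

definition V :: "('a \<times> real) set" where
  "V = {X. \<exists>c \<rho>. admissible c \<rho> \<and> X \<in> cball c \<rho>}"

text \<open>An infimum, since \<open>V\<close> is not claimed to be closed; contact of the graph of
  \<open>G\<close> with a ball is recovered by a limit.\<close>

definition G :: "'a \<Rightarrow> real" where
  "G x = Inf {s. (x, s) \<in> V}"

lemma V_subset: "V \<subseteq> epigraph U f"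
  by (auto simp: V_def admissible_def)

lemma V_ge: "(x, s) \<in> V \<Longrightarrow> x \<in> U \<and> f x \<le> s"
  using V_subset by (auto simp: mem_epigraph)

lemma admissible_cball: "admissible c \<rho> \<Longrightarrow> cball c \<rho> \<subseteq> V"
  unfolding V_def by blast

text \<open>The convex combination of two balls, as a Minkowski sum, is the ball with combined
  centre and radius. It stays in the convex epigraph, and the lower bounds are affine in centre and
  radius.\<close>

lemma admissible_convex:
  assumes 1: "admissible c \<rho>" and 2: "admissible c' \<rho>'" and uv: "u \<ge> 0" "v \<ge> 0" "u + v = 1"
  shows "admissible (u *\<^sub>R c + v *\<^sub>R c') (u * \<rho> + v * \<rho>')"
proof -
  define R where "R = u * \<rho> + v * \<rho>'"
  define C where "C = u *\<^sub>R c + v *\<^sub>R c'"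
  have "R > 0"
    using 1 2 uv by (auto simp: R_def admissible_def) (smt (verit) mult_nonneg_nonneg mult_pos_pos)
  have "cball C R \<subseteq> epigraph U f"
  proof
    fix Y assume "Y \<in> cball C R"
    then have Y: "norm (Y - C) \<le> R" by (simp add: dist_norm norm_minus_commute)
    have mem: "d + (s / R) *\<^sub>R (Y - C) \<in> cball d s" if "s > 0" for d s
    proof -
      have "s / R * norm (Y - C) \<le> s / R * R" using that Y \<open>R > 0\<close> by (intro mult_left_mono) auto
      then show ?thesis using that \<open>R > 0\<close> by (simp add: dist_norm)
    qed
    have "c + (\<rho> / R) *\<^sub>R (Y - C) \<in> epigraph U f" "c' + (\<rho>' / R) *\<^sub>R (Y - C) \<in> epigraph U f"
      using mem[of \<rho> c] mem[of \<rho>' c'] 1 2 unfolding admissible_def by blast+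
    then have "u *\<^sub>R (c + (\<rho> / R) *\<^sub>R (Y - C)) + v *\<^sub>R (c' + (\<rho>' / R) *\<^sub>R (Y - C)) \<in> epigraph U f"
      using convex_epigraphI[OF f] uv by (auto simp: convex_def)
    also have "u *\<^sub>R (c + (\<rho> / R) *\<^sub>R (Y - C)) + v *\<^sub>R (c' + (\<rho>' / R) *\<^sub>R (Y - C))
        = C + ((u * \<rho> + v * \<rho>') / R) *\<^sub>R (Y - C)"
      by (simp add: C_def scaleR_add_right add_divide_distrib scaleR_add_left)
    also have "\<dots> = Y" using \<open>R > 0\<close> by (simp flip: R_def)
    finally show "Y \<in> epigraph U f" .
  qed
  moreover have "r k * (1 - snd C / (real k + 1)) \<le> R" for k
  proof -
    have "r k * (1 - snd C / (real k + 1)) = u * (r k * (1 - snd c / (real k + 1))) + v * (r k * (1 - snd c' / (real k + 1)))"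
    proof -
      have "1 - snd C / (real k + 1) = (u + v) - (u * snd c + v * snd c') / (real k + 1)"
        using uv by (simp add: C_def)
      then show ?thesis by (simp only:) (simp add: algebra_simps add_divide_distrib)
    qed
    also have "\<dots> \<le> R"
      unfolding R_def using 1 2 uv by (intro add_mono mult_left_mono) (auto simp: admissible_def)
    finally show ?thesis .
  qed
  ultimately show ?thesis using \<open>R > 0\<close> by (simp add: admissible_def C_def R_def)
qed

lemma V_convex:
  assumes X: "X \<in> V" and Y: "Y \<in> V" and uv: "u \<ge> 0" "v \<ge> 0" "u + v = 1"
  shows "u *\<^sub>R X + v *\<^sub>R Y \<in> V"
proof -
  obtain c \<rho> c' \<rho>' where 1: "admissible c \<rho>" "X \<in> cball c \<rho>" and 2: "admissible c' \<rho>'" "Y \<in> cball c' \<rho>'"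
    using X Y by (auto simp: V_def)
  have "dist (u *\<^sub>R c + v *\<^sub>R c') (u *\<^sub>R X + v *\<^sub>R Y) = norm (u *\<^sub>R (c - X) + v *\<^sub>R (c' - Y))"
    by (simp add: dist_norm algebra_simps)
  also have "\<dots> \<le> u * norm (c - X) + v * norm (c' - Y)"
    using uv by (metis abs_of_nonneg norm_scaleR norm_triangle_ineq)
  also have "\<dots> \<le> u * \<rho> + v * \<rho>'"
    using 1 2 uv by (intro add_mono mult_left_mono) (auto simp: dist_norm)
  finally show ?thesis
    using admissible_convex[OF 1(1) 2(1) uv] by (auto simp: V_def)
qed

text \<open>For \<open>k < j\<close> the bracket is not positive, because
  \<open>t \<ge> real j \<ge> real k + 1\<close>; for \<open>k \<ge> j\<close> it is at most 1 and
  \<open>r k \<le> r j\<close>.\<close>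

lemma radius_admissible:
  assumes "real j \<le> t"
  shows "r k * (1 - t / (real k + 1)) \<le> r j"
proof (cases "k < j")
  case True
  then have "1 - t / (real k + 1) \<le> 0" using assms by (simp add: field_simps)
  then have "r k * (1 - t / (real k + 1)) \<le> 0" using r_pos[of k] by (simp add: mult_le_0_iff)
  then show ?thesis using r_pos[of j] by simp
next
  case False
  have "r k * (1 - t / (real k + 1)) \<le> r k * 1"
    using r_pos[of k] assms by (intro mult_left_mono) (auto simp: field_simps)
  also have "\<dots> \<le> r j" using r_mono False by (simp add: antimonoD)
  finally show ?thesis .
qed

text \<open>A centre at a large height \<open>j\<close> above \<open>x\<close> may use the radius
  \<open>r j\<close>, which \<open>r_le\<close> makes small enough for the ball to fit over a
  neighbourhood where \<open>f\<close> is bounded.\<close>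

lemma V_nonempty:
  assumes x: "x \<in> U"
  obtains s where "(x, s) \<in> V"
proof -
  obtain R L where R: "R > 0" "cball x R \<subseteq> U" and L: "\<forall>y\<in>cball x R. \<bar>f y\<bar> \<le> L"
    by (rule convex_on_locally_bounded_subgradient[OF U f x]) (rule that)
  obtain j :: nat where j: "real j \<ge> max (L + 1) (1 / R)" using real_arch_simple by blast
  have "1 / (real j + 1) \<le> R" using j R(1) by (simp add: field_simps)
  then have rj: "r j \<le> R" using r_le[of j] by simp
  have "1 / (real j + 1) \<le> 1" by (simp add: divide_le_eq)
  then have rj1: "r j \<le> 1" using r_le[of j] by linarith
  have "admissible (x, real j) (r j)"
    unfolding admissible_def
  proof (intro conjI allI)
    show "cball (x, real j) (r j) \<subseteq> epigraph U f"
    proof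
      fix Y assume Y: "Y \<in> cball (x, real j) (r j)"
      have "dist x (fst Y) \<le> r j" "dist (real j) (snd Y) \<le> r j"
        using Y dist_fst_le[of "(x, real j)" Y] dist_snd_le[of "(x, real j)" Y] by auto
      then have "fst Y \<in> cball x R" "snd Y \<ge> L" using rj rj1 j by (auto simp: dist_real_def)
      then show "Y \<in> epigraph U f" using R bspec[OF L, of "fst Y"] by (auto simp: epigraph_def)
    qed
  qed (use radius_admissible r_pos in auto)
  then show thesis
    using r_pos[of j] by (intro that[of "real j"]) (auto simp: V_def intro!: exI[of _ "(x, real j)"] less_imp_le)
qed

lemma G_le: "(x, s) \<in> V \<Longrightarrow> G x \<le> s"
  unfolding G_def by (rule cInf_lower) (use V_ge in \<open>auto intro!: bdd_belowI\<close>)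

lemma G_ge: "x \<in> U \<Longrightarrow> f x \<le> G x"
  unfolding G_def by (rule cInf_greatest) (use V_nonempty[of x] V_ge in blast)+

lemma G_approx:
  assumes "x \<in> U" "e > 0"
  obtains s where "(x, s) \<in> V" "s < G x + e"
proof -
  have "{s. (x, s) \<in> V} \<noteq> {}" using V_nonempty[OF \<open>x \<in> U\<close>] by blast
  then show thesis
    using cInf_lessD[of "{s. (x, s) \<in> V}" "G x + e"] assms that by (auto simp: G_def)
qed

lemma G_convex: "convex_on U G"
  unfolding convex_on_def
proof (intro conjI ballI allI impI)
  show "convex U" using f by (rule convex_on_imp_convex)
  fix x y and u v :: real assume xy: "x \<in> U" "y \<in> U" and uv: "0 \<le> u" "0 \<le> v" "u + v = 1"
  show "G (u *\<^sub>R x + v *\<^sub>R y) \<le> u * G x + v * G y"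
  proof (rule field_le_epsilon)
    fix e :: real assume "e > 0"
    obtain s t where s: "(x, s) \<in> V" "s < G x + e" and t: "(y, t) \<in> V" "t < G y + e"
      using G_approx xy \<open>e > 0\<close> by metis
    have "(u *\<^sub>R x + v *\<^sub>R y, u * s + v * t) \<in> V"
      using V_convex[OF s(1) t(1) uv] by simp
    then have "G (u *\<^sub>R x + v *\<^sub>R y) \<le> u * s + v * t" by (rule G_le)
    also have "\<dots> \<le> u * (G x + e) + v * (G y + e)"
      using s t uv by (intro add_mono mult_left_mono) auto
    also have "\<dots> = u * G x + v * G y + (u + v) * e" by (simp add: algebra_simps)
    finally show "G (u *\<^sub>R x + v *\<^sub>R y) \<le> u * G x + v * G y + e" using uv by simp
  qed
qed

lemma G_eq:
  assumes x: "x \<in> ball_touched U f (r j)" and j: "real j \<le> f x"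
  shows "G x = f x"
proof -
  obtain c where c: "x \<in> U" "cball c (r j) \<subseteq> epigraph U f" "(x, f x) \<in> cball c (r j)"
    using x by (auto simp: ball_touched_def)
  have "snd c \<ge> f x"
  proof (rule ccontr)
    assume "\<not> snd c \<ge> f x"
    \<comment> \<open>If the centre were lower than the contact point, reflection at its height
      would give a point of the ball below the graph.\<close>
    moreover have "(x, 2 * snd c - f x) \<in> cball c (r j)"
      using c(3) by (simp add: dist_prod_def dist_real_def power2_commute algebra_simps)
    ultimately show False using c(2) by (auto simp: mem_epigraph)
  qed
  then have "admissible c (r j)"
    unfolding admissible_def using c(2) j r_pos radius_admissible[of j "snd c"] by auto
  then have "(x, f x) \<in> V" using c(3) by (auto simp: V_def)
  then show ?thesis using G_le G_ge[OF c(1)] by (simp add: order_antisym)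
qed

text \<open>A ball of radius less than 1 through a point of height at most \<open>M\<close> has its
  centre at height at most \<open>M + 1\<close>, where the bound with index \<open>k > M\<close> is
  still positive. All larger balls are shrunk about the given point.\<close>

lemma V_uniform_ball:
  obtains \<rho> where "\<rho> > 0" "\<And>x s. (x, s) \<in> V \<Longrightarrow> s \<le> M \<Longrightarrow> \<exists>c. cball c \<rho> \<subseteq> V \<and> (x, s) \<in> cball c \<rho>"
proof -
  obtain k :: nat where k: "real k > M" using reals_Archimedean2 by blast
  define \<rho> where "\<rho> = min 1 (r k * (1 - (M + 1) / (real k + 1)))"
  have "(M + 1) / (real k + 1) < 1" using k by (simp add: divide_less_eq)
  then have "\<rho> > 0" using r_pos[of k] by (simp add: \<rho>_def)
  moreover have "\<exists>c. cball c \<rho> \<subseteq> V \<and> (x, s) \<in> cball c \<rho>" if xs: "(x, s) \<in> V" "s \<le> M" for x s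
  proof -
    obtain c t where ct: "admissible c t" "(x, s) \<in> cball c t" using xs by (auto simp: V_def)
    have "\<rho> \<le> t"
    proof (cases "t \<ge> 1")
      case False
      have "dist (snd c) s \<le> t" using ct(2) dist_snd_le[of c "(x, s)"] by simp
      then have "snd c \<le> M + 1" using xs False by (simp add: dist_real_def)
      then have "r k * (1 - (M + 1) / (real k + 1)) \<le> r k * (1 - snd c / (real k + 1))"
        using r_pos[of k] by (intro mult_left_mono diff_left_mono divide_right_mono) auto
      also have "\<dots> \<le> t" using ct(1) by (simp add: admissible_def)
      finally show ?thesis by (simp add: \<rho>_def)
    qed (simp add: \<rho>_def)
    with cball_shrink_about[OF ct(2) \<open>\<rho> > 0\<close>] admissible_cball[OF ct(1)] show ?thesis
      by (metis order_trans)
  qed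
  ultimately show thesis by (rule that)
qed

lemma V_subset_epigraph: "V \<subseteq> epigraph U G"
  using V_ge G_le by (auto simp: epigraph_def)

lemma closed_epigraph_G: "closed (epigraph U G)"
proof (rule closed_epigraph)
  show cont: "continuous_on U G" by (rule convex_on_continuous[OF U G_convex])
  fix c
  let ?K = "{x\<in>U. f x \<le> c}"
  have "closed {x \<in> ?K. G x \<le> c}"
    by (intro continuous_on_closed_Collect_le continuous_on_subset[OF cont] compact_imp_closed comp continuous_on_const) auto
  moreover have "{x \<in> ?K. G x \<le> c} \<subseteq> ?K" by auto
  ultimately have "compact {x \<in> ?K. G x \<le> c}"
    using comp compact_imp_bounded bounded_subset compact_eq_bounded_closed by blast
  also have "{x \<in> ?K. G x \<le> c} = {x\<in>U. G x \<le> c}"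
    using G_ge by force
  finally show "compact {x\<in>U. G x \<le> c}" .
qed

text \<open>Points of \<open>V\<close> descending to \<open>(x, G x)\<close> lie in balls of one
  radius with bounded centres. A limit of these balls contains \<open>(x, G x)\<close> and lies in
  the closed epigraph. The strict bound \<open>G x < M\<close> leaves room for the approximating
  heights.\<close>

lemma G_touching_ball:
  obtains \<rho> where "\<rho> > 0"
    "\<forall>x\<in>U. G x < M \<longrightarrow> (\<exists>c. cball c \<rho> \<subseteq> epigraph U G \<and> (x, G x) \<in> cball c \<rho>)"
proof -
  obtain \<rho> where "\<rho> > 0" and \<rho>: "\<And>x s. (x, s) \<in> V \<Longrightarrow> s \<le> M \<Longrightarrow> \<exists>c. cball c \<rho> \<subseteq> V \<and> (x, s) \<in> cball c \<rho>"
    using V_uniform_ball by blast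
  have "\<exists>c. cball c \<rho> \<subseteq> epigraph U G \<and> (x, G x) \<in> cball c \<rho>" if x: "x \<in> U" "G x < M" for x
  proof -
    define e where "e n = (M - G x) / real (Suc n)" for n
    have e: "e n > 0" "e n \<le> M - G x" for n
      using x divide_left_mono[of 1 "real (Suc n)" "M - G x"] by (auto simp: e_def)
    have "\<exists>s c. G x \<le> s \<and> s \<le> G x + e n \<and> cball c \<rho> \<subseteq> V \<and> (x, s) \<in> cball c \<rho>" for n
    proof -
      obtain s where s: "(x, s) \<in> V" "s < G x + e n" using G_approx[OF x(1) e(1)] .
      moreover have "s \<le> M" using s(2) e(2)[of n] by simp
      ultimately show ?thesis using \<rho> G_le by (meson less_imp_le)
    qed
    then obtain s c where s: "\<And>n. G x \<le> s n" "\<And>n. s n \<le> G x + e n"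
      and c: "\<And>n. cball (c n) \<rho> \<subseteq> V" "\<And>n. (x, s n) \<in> cball (c n) \<rho>" by metis
    have "(\<lambda>n. (M - G x) * (1 / real (Suc n))) \<longlonglongrightarrow> (M - G x) * 0"
      using LIMSEQ_inverse_real_of_nat by (intro tendsto_intros) (simp add: inverse_eq_divide)
    then have "(\<lambda>n. G x + e n) \<longlonglongrightarrow> G x + 0"
      by (intro tendsto_intros) (simp add: e_def)
    then have slim: "s \<longlonglongrightarrow> G x"
      using s by (intro tendsto_sandwich[of "\<lambda>_. G x" s _ "\<lambda>n. G x + e n"]) auto
    have "c n \<in> cball (x, G x) (\<rho> + (M - G x))" for n
    proof -
      have "dist (x, s n) (x, G x) \<le> M - G x"
        using s(1,2)[of n] e(2)[of n] by (simp add: dist_Pair_Pair dist_real_def)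
      then show ?thesis
        using c(2)[of n] dist_triangle[of "(x, G x)" "c n" "(x, s n)"] by (simp add: dist_commute)
    qed
    then obtain l \<phi> where \<phi>: "strict_mono \<phi>" and lim: "(c \<circ> \<phi>) \<longlonglongrightarrow> l"
      using compact_cball[of "(x, G x)" "\<rho> + (M - G x)"] unfolding compact_def by metis
    have "cball l \<rho> \<subseteq> epigraph U G"
    proof
      fix Y assume Y: "Y \<in> cball l \<rho>"
      have "(\<lambda>n. (Y - l) + (c \<circ> \<phi>) n) \<longlonglongrightarrow> (Y - l) + l" by (intro tendsto_intros lim)
      moreover have "(Y - l) + (c \<circ> \<phi>) n \<in> epigraph U G" for n
      proof -
        have "(Y - l) + c (\<phi> n) \<in> cball (c (\<phi> n)) \<rho>"
          using Y by (simp add: dist_norm norm_minus_commute)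
        then show ?thesis using c(1) V_subset_epigraph by (auto simp del: mem_cball)
      qed
      ultimately show "Y \<in> epigraph U G"
        using closed_sequentially[OF closed_epigraph_G] by fastforce
    qed
    moreover have "dist l (x, G x) \<le> \<rho>"
    proof (rule LIMSEQ_le_const2)
      show "(\<lambda>n. dist ((c \<circ> \<phi>) n) (x, (s \<circ> \<phi>) n)) \<longlonglongrightarrow> dist l (x, G x)"
        by (intro tendsto_intros lim LIMSEQ_subseq_LIMSEQ[OF slim \<phi>])
      show "\<exists>N. \<forall>n\<ge>N. dist ((c \<circ> \<phi>) n) (x, (s \<circ> \<phi>) n) \<le> \<rho>"
        using c(2) by auto
    qed
    ultimately show ?thesis by auto
  qed
  with \<open>\<rho> > 0\<close> show thesis by (intro that) auto
qed

lemma G_C11: "C11_loc_on U G"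
proof (rule C11_loc_on_of_quadratic_bounds[OF U])
  fix x0 assume "x0 \<in> U"
  obtain R L where R: "R > 0" "L > 0" "cball x0 R \<subseteq> U"
    and sub: "\<forall>x\<in>cball x0 R. \<forall>p. subgradient_on U G x p \<longrightarrow> norm p \<le> L"
    and L: "\<forall>x\<in>cball x0 R. \<bar>G x\<bar> \<le> L"
    by (rule convex_on_locally_bounded_subgradient[OF U G_convex \<open>x0 \<in> U\<close>]) (rule that)
  obtain \<rho> where "\<rho> > 0"
    and \<rho>: "\<forall>x\<in>U. G x < L + 1 \<longrightarrow> (\<exists>c. cball c \<rho> \<subseteq> epigraph U G \<and> (x, G x) \<in> cball c \<rho>)"
    by (rule G_touching_ball[of "L + 1"]) (rule that)
  define C where "C = (1 + (L + 1)\<^sup>2) * sqrt (1 + L\<^sup>2) / (2 * \<rho>)"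
  have "C > 0"
    unfolding C_def using \<open>\<rho> > 0\<close> by (intro divide_pos_pos mult_pos_pos) (auto simp: add_pos_nonneg)
  define d where "d = min R (1 / C)"
  show "\<exists>d>0. \<exists>C\<ge>0. \<forall>x\<in>ball x0 d. \<exists>p. subgradient_on U G x p \<and>
      (\<forall>h. norm h \<le> d \<longrightarrow> x + h \<in> U \<and> G (x + h) \<le> G x + p \<bullet> h + C * (norm h)\<^sup>2)"
  proof (rule exI[of _ d], intro conjI, goal_cases)
    case 1 show ?case using R \<open>C > 0\<close> by (simp add: d_def)
  next
    case 2 show ?case
    proof (rule exI[of _ C], intro conjI ballI)
      fix x assume "x \<in> ball x0 d"
      then have x: "x \<in> cball x0 R" by (auto simp: d_def)
      then have xU: "x \<in> U" using R by auto
      obtain p where p: "subgradient_on U G x p"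
        using convex_on_subgradient_exists[OF U G_convex xU] .
      have "G x < L + 1" using bspec[OF L x] by simp
      with \<rho> xU obtain c where c: "cball c \<rho> \<subseteq> epigraph U G" "(x, G x) \<in> cball c \<rho>" by blast
      show "\<exists>p. subgradient_on U G x p \<and>
          (\<forall>h. norm h \<le> d \<longrightarrow> x + h \<in> U \<and> G (x + h) \<le> G x + p \<bullet> h + C * (norm h)\<^sup>2)"
      proof (intro exI[of _ p] conjI p allI impI)
        fix h :: 'a assume "norm h \<le> d"
        then have "norm h \<le> 1 / C" by (simp add: d_def)
        then have "C * norm h \<le> 1" using \<open>C > 0\<close> by (simp add: field_simps)
        have "norm p \<le> L" using sub x p by blast
        from upper_paraboloid_of_touching_ball[OF p this \<open>\<rho> > 0\<close> c C_def \<open>C * norm h \<le> 1\<close>]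
        show "x + h \<in> U" "G (x + h) \<le> G x + p \<bullet> h + C * (norm h)\<^sup>2" by auto
      qed
    qed (use \<open>C > 0\<close> in simp)
  qed
qed

end

lemma C11_approximation_of_compact_sublevels:
  fixes f :: "'a::euclidean_space \<Rightarrow> real"
  assumes U: "open U" and f: "convex_on U f" and nonneg: "\<And>x. x \<in> U \<Longrightarrow> 0 \<le> f x"
    and comp: "\<And>c. compact {x\<in>U. f x \<le> c}" and "\<epsilon> > 0"
  obtains g where "convex_on U g" "C11_loc_on U g" "\<And>x. x \<in> U \<Longrightarrow> f x \<le> g x"
    "emeasure lebesgue {x\<in>U. f x \<noteq> g x} < ennreal \<epsilon>"
proof -
  obtain r :: "nat \<Rightarrow> real" where r: "\<forall>j. 0 < r j" "\<forall>j. r j \<le> 1 / (real j + 1)" "antimono r"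
    and m: "emeasure lebesgue (\<Union>j. {x\<in>U. f x \<le> real j + 1} - ball_touched U f (r j)) < ennreal \<epsilon>"
      "range (\<lambda>j. {x\<in>U. f x \<le> real j + 1} - ball_touched U f (r j)) \<subseteq> sets lebesgue"
    by (rule touching_radii[OF U f comp \<open>\<epsilon> > 0\<close>]) (rule that)
  interpret ball_smoothing U f r
    by (rule ball_smoothing.intro[OF U f nonneg comp]) (use r in blast)+
  have "{x\<in>U. f x \<noteq> G x} \<subseteq> (\<Union>j. {x\<in>U. f x \<le> real j + 1} - ball_touched U f (r j))"
  proof
    fix x assume x: "x \<in> {x\<in>U. f x \<noteq> G x}"
    \<comment> \<open>The height class of \<open>x\<close>: a touching ball of radius
      \<open>r j\<close> there would force \<open>G x = f x\<close>.\<close>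
    define j where "j = nat \<lfloor>f x\<rfloor>"
    have "real j \<le> f x" "f x \<le> real j + 1" using nonneg[of x] x unfolding j_def by auto
    then show "x \<in> (\<Union>j. {x\<in>U. f x \<le> real j + 1} - ball_touched U f (r j))"
      using x G_eq[of x j] by auto
  qed
  then have "emeasure lebesgue {x\<in>U. f x \<noteq> G x} \<le> emeasure lebesgue (\<Union>j. {x\<in>U. f x \<le> real j + 1} - ball_touched U f (r j))"
    using m(2) by (intro emeasure_mono) auto
  with m(1) have "emeasure lebesgue {x\<in>U. f x \<noteq> G x} < ennreal \<epsilon>" by (rule le_less_trans[rotated])
  then show thesis using that G_convex G_C11 G_ge by blast
qed

section \<open>Reduction to compact sublevel sets\<close>

text \<open>For a point of \<open>U\<close>, the distance to the complement is the largest radius of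
  an open ball about it inside \<open>U\<close>; combining the balls at \<open>x\<close> and
  \<open>y\<close> gives a ball of radius \<open>D\<close> at the combined point.\<close>

lemma infdist_compl_concave:
  fixes x y :: "'a::euclidean_space"
  assumes U: "open U" "convex U" "U \<noteq> UNIV" and xy: "x \<in> U" "y \<in> U"
    and uv: "0 \<le> u" "0 \<le> v" "u + v = 1"
  shows "u * infdist x (- U) + v * infdist y (- U) \<le> infdist (u *\<^sub>R x + v *\<^sub>R y) (- U)"
proof -
  define D where "D = u * infdist x (- U) + v * infdist y (- U)"
  have ne: "- U \<noteq> {}" using U(3) by auto
  have in_U: "w \<in> U" if "dist z w < infdist z (- U)" for z w
    using infdist_le[of w "- U" z] that by force
  have pos: "infdist z (- U) > 0" if "z \<in> U" for z
    using infdist_pos_not_in_closed[of "- U" z] U ne that by auto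
  have "D > 0"
    using pos[OF xy(1)] pos[OF xy(2)] uv unfolding D_def
    by (cases "u = 0") (auto intro: add_pos_nonneg)
  have "D \<le> dist (u *\<^sub>R x + v *\<^sub>R y) z" if z: "z \<in> - U" for z
  proof (rule ccontr)
    define w where "w = z - (u *\<^sub>R x + v *\<^sub>R y)"
    assume "\<not> D \<le> dist (u *\<^sub>R x + v *\<^sub>R y) z"
    then have w: "norm w < D" by (simp add: w_def dist_norm norm_minus_commute)
    have mem: "q + (infdist q (- U) / D) *\<^sub>R w \<in> U" if "q \<in> U" for q
    proof (rule in_U)
      have "infdist q (- U) / D * norm w < infdist q (- U) / D * D"
        using w pos[OF that] \<open>D > 0\<close> by (intro mult_strict_left_mono) auto
      then show "dist q (q + (infdist q (- U) / D) *\<^sub>R w) < infdist q (- U)"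
        using \<open>D > 0\<close> pos[OF that] by (simp add: dist_norm)
    qed
    have "u *\<^sub>R (x + (infdist x (- U) / D) *\<^sub>R w) + v *\<^sub>R (y + (infdist y (- U) / D) *\<^sub>R w) \<in> U"
      using mem[OF xy(1)] mem[OF xy(2)] uv U(2) by (auto simp: convex_def)
    also have "u *\<^sub>R (x + (infdist x (- U) / D) *\<^sub>R w) + v *\<^sub>R (y + (infdist y (- U) / D) *\<^sub>R w)
       = u *\<^sub>R x + v *\<^sub>R y + (D / D) *\<^sub>R w"
      unfolding D_def scaleR_add_right add_divide_distrib scaleR_add_left by simp
    also have "\<dots> = z" using \<open>D > 0\<close> by (simp add: w_def)
    finally show False using z by simp
  qed
  then have "D \<le> infdist (u *\<^sub>R x + v *\<^sub>R y) (- U)"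
    unfolding infdist_notempty[OF ne] by (rule cINF_greatest[OF ne])
  then show ?thesis by (simp add: D_def)
qed

text \<open>\<open>\<psi> j\<close> is convex, tends to \<open>j\<close> at the boundary, and is
  positive only within distance \<open>1 / m j\<close> of it. Hence it exceeds the nonnegative
  \<open>f\<close> only on a thin part of a bounded sublevel set, while all \<open>\<psi> j\<close>
  together force \<open>h\<close> to infinity at the boundary.\<close>

lemma compact_sublevel_majorant:
  fixes f :: "'a::euclidean_space \<Rightarrow> real"
  assumes U: "open U" and f: "convex_on U f" and nonneg: "\<And>x. x \<in> U \<Longrightarrow> 0 \<le> f x"
    and bdd: "\<And>c. bounded {x\<in>U. f x \<le> c}" and "\<epsilon> > 0"
  obtains h where "convex_on U h" "\<forall>x\<in>U. f x \<le> h x" "\<forall>c. compact {x\<in>U. h x \<le> c}"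
    "emeasure lebesgue {x\<in>U. f x \<noteq> h x} < ennreal \<epsilon>"
proof (cases "U = UNIV")
  case True
  have "continuous_on UNIV f" using convex_on_continuous[OF U f] True by simp
  then have "closed {x\<in>UNIV. f x \<le> c}" for c
    by (intro continuous_on_closed_Collect_le continuous_on_const) auto
  then show thesis
    using that[of f] f bdd True \<open>\<epsilon> > 0\<close> by (simp add: compact_eq_bounded_closed)
next
  case False
  have cU: "convex U" using f by (rule convex_on_imp_convex)
  have contf: "continuous_on U f" by (rule convex_on_continuous[OF U f])
  define d where "d x = infdist x (- U)" for x
  have contd: "continuous_on S d" for S unfolding d_def by (intro continuous_intros)
  have dpos: "d x > 0 \<longleftrightarrow> x \<in> U" for x
    using infdist_pos_not_in_closed[of "- U" x] U False by (cases "x \<in> U") (auto simp: d_def)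
  have dconc: "u * d x + v * d y \<le> d (u *\<^sub>R x + v *\<^sub>R y)"
    if "x \<in> U" "y \<in> U" "0 \<le> u" "0 \<le> v" "u + v = 1" for x y u v
    unfolding d_def using infdist_compl_concave[OF U cU False] that by blast
  define A where "A j n = {x\<in>U. f x \<le> real j} \<inter> {x. d x \<le> 1 / real (Suc n)}" for j n
  have Am: "A j n \<in> lmeasurable" for j n
  proof (rule bounded_set_imp_lmeasurable)
    show "bounded (A j n)" using bdd[of "real j"] by (rule bounded_subset) (auto simp: A_def)
    have "closedin (top_of_set U) (U \<inter> f -` {..real j})"
      by (intro continuous_closedin_preimage contf closed_atMost)
    also have "U \<inter> f -` {..real j} = {x\<in>U. f x \<le> real j}" by auto
    finally have "closedin (top_of_set U) {x\<in>U. f x \<le> real j}" .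
    moreover
    have "closed {x. d x \<le> 1 / real (Suc n)}"
      using continuous_on_closed_Collect_le[OF contd[of UNIV] continuous_on_const] by auto
    ultimately show "A j n \<in> sets lebesgue"
      using U by (auto simp: A_def closedin_closed)
  qed
  have "\<exists>n. emeasure lebesgue (A j n) \<le> ennreal (\<epsilon> / 2 ^ (j + 2))" for j
  proof (rule decseq_emeasure_small[of "A j" "\<epsilon> / 2 ^ (j + 2)"])
    show "decseq (A j)"
    proof (rule decseq_SucI)
      fix n
      have "1 / real (Suc (Suc n)) \<le> 1 / real (Suc n)" by (intro divide_left_mono) auto
      then show "A j (Suc n) \<subseteq> A j n" by (auto simp: A_def)
    qed
    have "(\<Inter>n. A j n) = {}"
    proof (rule ccontr)
      assume "(\<Inter>n. A j n) \<noteq> {}"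
      then obtain x where x: "\<And>n. x \<in> A j n" by auto
      then have "d x > 0" using dpos by (simp add: A_def)
      then obtain n where "1 / real (Suc n) < d x" using nat_approx_posE by blast
      then show False using x[of n] by (simp add: A_def)
    qed
    then show "negligible (\<Inter>n. A j n)" by simp
  qed (use \<open>\<epsilon> > 0\<close> Am in auto)
  then obtain n where n: "\<And>j. emeasure lebesgue (A j (n j)) \<le> ennreal (\<epsilon> / 2 ^ (j + 2))"
    by metis
  \<comment> \<open>\<open>m j\<close> is so large that \<open>\<psi> j\<close> exceeds \<open>f\<close> only on a thin layer at the boundary, and grows with \<open>j\<close>
    so that the supremum is finite.\<close>
  define m where "m j = real (Suc (n j + j))" for j
  have m: "m j \<ge> real j" "m j > 0" for j by (auto simp: m_def)
  define \<psi> where "\<psi> j x = real j * (1 - m j * d x)" for j x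
  define h where "h x = (SUP j. max (f x) (\<psi> j x))" for x
  have bound: "\<psi> j x \<le> 1 / d x" if x: "x \<in> U" for j x
  proof (cases "m j * d x \<le> 1")
    case True
    have "real j * d x \<le> m j * d x" using m[of j] dpos[of x] x by (intro mult_right_mono) auto
    then have "real j * d x \<le> 1" using True by simp
    then have "real j \<le> 1 / d x" using dpos[of x] x by (simp add: pos_le_divide_eq)
    moreover have "\<psi> j x \<le> real j * 1"
      unfolding \<psi>_def using m[of j] dpos[of x] x by (intro mult_left_mono) auto
    ultimately show ?thesis by simp
  next
    case False
    then have "\<psi> j x \<le> 0" by (simp add: \<psi>_def mult_le_0_iff)
    moreover have "0 \<le> 1 / d x" using dpos[of x] x by simp
    ultimately show ?thesis by linarith
  qed
  have bdda: "bdd_above (range (\<lambda>j. max (f x) (\<psi> j x)))" if "x \<in> U" for x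
    using bound[OF that] by (intro bdd_aboveI2[of _ _ "max (f x) (1 / d x)"] max.mono) auto
  have up: "max (f x) (\<psi> j x) \<le> h x" if "x \<in> U" for x j
    unfolding h_def using bdda[OF that] by (intro cSUP_upper) auto
  have fh: "f x \<le> h x" and \<psi>h: "\<psi> j x \<le> h x" if "x \<in> U" for x j
    using up[OF that] by auto
  have least: "h x \<le> c" if "f x \<le> c" "\<And>j. \<psi> j x \<le> c" for x c
    unfolding h_def using that by (intro cSUP_least) auto
  have h: "convex_on U h"
    unfolding convex_on_def
  proof (intro conjI ballI allI impI cU least)
    fix x y u v assume xy: "x \<in> U" "y \<in> U" and uv: "0 \<le> (u::real)" "0 \<le> v" "u + v = 1"
    have "f (u *\<^sub>R x + v *\<^sub>R y) \<le> u * f x + v * f y"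
      using f xy uv by (auto simp: convex_on_def)
    also have "\<dots> \<le> u * h x + v * h y" using fh xy uv by (intro add_mono mult_left_mono) auto
    finally show "f (u *\<^sub>R x + v *\<^sub>R y) \<le> u * h x + v * h y" .
    fix j
    have "\<psi> j (u *\<^sub>R x + v *\<^sub>R y) \<le> real j * (1 - m j * (u * d x + v * d y))"
      unfolding \<psi>_def using dconc[OF xy uv] m[of j] by (intro mult_left_mono diff_left_mono) auto
    also have "\<dots> = real j * ((u + v) - m j * (u * d x + v * d y))" using uv by simp
    also have "\<dots> = u * \<psi> j x + v * \<psi> j y" by (simp add: \<psi>_def algebra_simps)
    also have "\<dots> \<le> u * h x + v * h y" using \<psi>h xy uv by (intro add_mono mult_left_mono) auto
    finally show "\<psi> j (u *\<^sub>R x + v *\<^sub>R y) \<le> u * h x + v * h y" .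
  qed
  have "compact {x\<in>U. h x \<le> c}" for c
  proof -
    obtain j :: nat where j: "real j > max c 0" using reals_Archimedean2 by blast
    \<comment> \<open>Solving \<open>\<psi> j x \<le> c\<close> for \<open>d x\<close> gives this
      distance from the boundary, positive because \<open>real j > c\<close>.\<close>
    define \<tau> where "\<tau> = (real j - c) / (real j * m j)"
    have "\<tau> > 0" using j m[of j] by (simp add: \<tau>_def)
    obtain B where "\<forall>x\<in>{x\<in>U. f x \<le> c}. norm x \<le> B" using bdd[of c] unfolding bounded_iff by blast
    then have B: "{x\<in>U. f x \<le> c} \<subseteq> cball 0 B" by auto
    define K where "K = cball 0 B \<inter> {x\<in>UNIV. \<tau> \<le> d x}"
    have "compact K"
      unfolding K_def
      by (intro compact_Int_closed compact_cball continuous_on_closed_Collect_le continuous_on_const contd) auto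
    have "K \<subseteq> U" using dpos \<open>\<tau> > 0\<close> by (force simp: K_def)
    have "d x \<ge> \<tau>" if "x \<in> U" "h x \<le> c" for x
    proof -
      have "\<psi> j x \<le> c" using \<psi>h[OF that(1), of j] that(2) by simp
      then have "real j - c \<le> real j * m j * d x" by (simp add: \<psi>_def algebra_simps)
      then show ?thesis using j m[of j] by (simp add: \<tau>_def divide_le_eq mult.commute)
    qed
    then have "{x\<in>U. h x \<le> c} = {x\<in>K. h x \<le> c}"
      using \<open>K \<subseteq> U\<close> B fh by (force simp: K_def simp del: mem_cball)
    moreover have "closed {x\<in>K. h x \<le> c}"
      using convex_on_continuous[OF U h] \<open>K \<subseteq> U\<close> \<open>compact K\<close>
      by (intro continuous_on_closed_Collect_le continuous_on_const) (auto intro: continuous_on_subset compact_imp_closed)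
    moreover have "bounded {x\<in>K. h x \<le> c}"
      using \<open>compact K\<close> by (auto intro: bounded_subset compact_imp_bounded)
    ultimately show ?thesis by (simp add: compact_eq_bounded_closed)
  qed
  moreover have "emeasure lebesgue {x\<in>U. f x \<noteq> h x} < ennreal \<epsilon>"
  proof -
    have "{x\<in>U. f x \<noteq> h x} \<subseteq> (\<Union>j. A j (n j + j))"
    proof
      fix x assume x: "x \<in> {x\<in>U. f x \<noteq> h x}"
      have "\<not> (\<forall>j. \<psi> j x \<le> f x)"
      proof
        assume "\<forall>j. \<psi> j x \<le> f x"
        then have "h x \<le> f x" using least[of x "f x"] by simp
        then show False using x fh[of x] by simp
      qed
      then obtain j where j: "f x < \<psi> j x" by (auto simp: not_le)
      then have "0 < \<psi> j x" using nonneg[of x] x by auto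
      then have md: "m j * d x < 1" by (auto simp: \<psi>_def zero_less_mult_iff)
      have "d x > 0" using dpos x by simp
      then have "\<psi> j x \<le> real j * 1"
        unfolding \<psi>_def using m[of j] by (intro mult_left_mono) auto
      moreover have "d x \<le> 1 / m j" using md m[of j] by (simp add: field_simps)
      ultimately show "x \<in> (\<Union>j. A j (n j + j))"
        using x j by (auto simp: A_def m_def intro!: exI[of _ j])
    qed
    then have "emeasure lebesgue {x\<in>U. f x \<noteq> h x} \<le> emeasure lebesgue (\<Union>j. A j (n j + j))"
      using Am by (intro emeasure_mono) (auto simp: fmeasurableD)
    also have "\<dots> < ennreal \<epsilon>"
    proof (rule emeasure_UN_less[OF _ \<open>\<epsilon> > 0\<close>])
      fix j
      have "1 / real (Suc (n j + j)) \<le> 1 / real (Suc (n j))" by (intro divide_left_mono) auto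
      then have "A j (n j + j) \<subseteq> A j (n j)" by (auto simp: A_def)
      then show "emeasure lebesgue (A j (n j + j)) \<le> ennreal (\<epsilon> / 2 ^ (j + 2))"
        using n[of j] Am by (meson emeasure_mono fmeasurableD order_trans)
    qed (use Am in \<open>auto simp: fmeasurableD\<close>)
    finally show ?thesis .
  qed
  ultimately show thesis using that h fh by blast
qed

section \<open>Coercivity, up to an affine function, when the graph contains no line\<close>

lemma is_line_affine:
  fixes a :: "'a::real_normed_vector"
  assumes "b \<noteq> 0"
  shows "is_line (range (\<lambda>t::real. a + t *\<^sub>R b))"
  unfolding is_line_def
proof (intro exI[of _ "\<lambda>t. a + (t / norm b) *\<^sub>R b"] conjI allI)
  show "range (\<lambda>t. a + (t / norm b) *\<^sub>R b) = range (\<lambda>t. a + t *\<^sub>R b)"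
  proof (intro equalityI subsetI; clarify)
    show "a + t *\<^sub>R b \<in> range (\<lambda>t. a + (t / norm b) *\<^sub>R b)" for t
      using assms by (intro range_eqI[of _ _ "t * norm b"]) simp
  qed auto
  fix s t :: real
  have "a + (s / norm b) *\<^sub>R b - (a + (t / norm b) *\<^sub>R b) = ((s - t) / norm b) *\<^sub>R b"
    by (simp add: diff_divide_distrib scaleR_left_diff_distrib)
  then show "dist (a + (s / norm b) *\<^sub>R b) (a + (t / norm b) *\<^sub>R b) = dist s t"
    using assms by (simp add: dist_norm)
qed

text \<open>The functionals dominated by \<open>f\<close> include the subgradients, and remain dominated after adding an
  outer normal of \<open>U\<close>. If all of them have the same value \<open>b\<close> at \<open>a\<close>, then no normal of \<open>U\<close> obstructs
  the direction \<open>a\<close> and \<open>f\<close> has slope \<open>b\<close> along it.\<close>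

lemma line_of_subgradients_in_hyperplane:
  fixes f :: "'a::euclidean_space \<Rightarrow> real"
  assumes U: "open U" and f: "convex_on U f" and "x \<in> U" and "a \<noteq> 0"
    and D: "\<And>v c. \<forall>y\<in>U. v \<bullet> y - c \<le> f y \<Longrightarrow> a \<bullet> v = b"
  shows "\<exists>l. is_line l \<and> l \<subseteq> graph_on U f"
proof -
  have cU: "convex U" using f by (rule convex_on_imp_convex)
  have sub: "p \<bullet> a = b" if "y \<in> U" "subgradient_on U f y p" for y p
  proof -
    have "\<forall>z\<in>U. p \<bullet> z - (p \<bullet> y - f y) \<le> f z"
      using that(2) by (auto simp: subgradient_on_def inner_diff_right algebra_simps)
    from D[OF this] show ?thesis by (simp add: inner_commute)
  qed
  have inU: "x + t *\<^sub>R a \<in> U" for t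
  proof (rule ccontr)
    define z where "z = x + t *\<^sub>R a"
    assume "x + t *\<^sub>R a \<notin> U"
    then have "\<exists>c \<beta>. c \<noteq> 0 \<and> (\<forall>y\<in>U. c \<bullet> y \<le> \<beta>) \<and> (\<forall>y\<in>{z}. \<beta> \<le> c \<bullet> y)"
      using cU \<open>x \<in> U\<close> by (intro separating_hyperplane_sets) (auto simp: z_def)
    then obtain c \<beta> where "c \<noteq> 0" and c: "\<And>y. y \<in> U \<Longrightarrow> c \<bullet> y \<le> \<beta>" "\<beta> \<le> c \<bullet> z" by auto
    obtain p where p: "subgradient_on U f x p" using convex_on_subgradient_exists[OF U f \<open>x \<in> U\<close>] .
    have "\<forall>y\<in>U. (p + c) \<bullet> y - (p \<bullet> x - f x + \<beta>) \<le> f y"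
    proof
      fix y assume y: "y \<in> U"
      then have "f x + p \<bullet> (y - x) \<le> f y" using p by (simp add: subgradient_on_def)
      then show "(p + c) \<bullet> y - (p \<bullet> x - f x + \<beta>) \<le> f y"
        using c(1)[OF y] by (simp add: inner_add_left inner_diff_right)
    qed
    from D[OF this] sub[OF \<open>x \<in> U\<close> p] have "c \<bullet> a = 0"
      by (simp add: inner_add_right inner_commute)
    then have "\<beta> \<le> c \<bullet> x" using c(2) by (simp add: z_def inner_add_right)
    obtain e where "e > 0" "cball x e \<subseteq> U" using U \<open>x \<in> U\<close> open_contains_cball by blast
    then have "x + (e / norm c) *\<^sub>R c \<in> U" using \<open>c \<noteq> 0\<close> by (auto simp: subset_iff dist_norm)
    from c(1)[OF this] \<open>\<beta> \<le> c \<bullet> x\<close> have "(e / norm c) * (c \<bullet> c) \<le> 0"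
      by (simp add: inner_add_right)
    moreover have "(e / norm c) * (c \<bullet> c) > 0"
      using \<open>e > 0\<close> \<open>c \<noteq> 0\<close> by (intro mult_pos_pos) auto
    ultimately show False by simp
  qed
  \<comment> \<open>A subgradient at \<open>x\<close> bounds the value from below and one at
    \<open>x + t *\<^sub>R a\<close> bounds it from above, with the same slope \<open>b\<close>
    along \<open>a\<close>.\<close>
  have val: "f (x + t *\<^sub>R a) = f x + t * b" for t
  proof (rule antisym)
    obtain p where p: "subgradient_on U f x p" using convex_on_subgradient_exists[OF U f \<open>x \<in> U\<close>] .
    then have "f x + p \<bullet> (t *\<^sub>R a) \<le> f (x + t *\<^sub>R a)"
      using inU[of t] by (fastforce simp: subgradient_on_def)
    then show "f x + t * b \<le> f (x + t *\<^sub>R a)" using sub[OF \<open>x \<in> U\<close> p] by simp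
    obtain q where q: "subgradient_on U f (x + t *\<^sub>R a) q" using convex_on_subgradient_exists[OF U f inU] .
    then have "f (x + t *\<^sub>R a) + q \<bullet> (x - (x + t *\<^sub>R a)) \<le> f x"
      using \<open>x \<in> U\<close> by (simp only: subgradient_on_def)
    then show "f (x + t *\<^sub>R a) \<le> f x + t * b" using sub[OF inU q] by simp
  qed
  have "range (\<lambda>t::real. (x, f x) + t *\<^sub>R (a, b)) \<subseteq> graph_on U f"
    using inU val by (auto simp: graph_on_def)
  moreover have "is_line (range (\<lambda>t::real. (x, f x) + t *\<^sub>R (a, b)))"
    using \<open>a \<noteq> 0\<close> by (intro is_line_affine) (auto simp: zero_prod_def)
  ultimately show ?thesis by blast
qed

text \<open>\<open>D\<close> is the domain of the conjugate. If it contains a ball of radius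
  \<open>e\<close> about \<open>v\<close>, the minorants with slopes
  \<open>v + e *\<^sub>R i\<close> and \<open>v - e *\<^sub>R i\<close> bound every coordinate on a
  sublevel set of the tilted function. Otherwise the convex set \<open>D\<close> lies in a
  hyperplane \<open>{v. a \<bullet> v = b}\<close>, and \<open>(a, b)\<close> is the direction of a
  line in the graph.\<close>

lemma coercive_tilt:
  fixes f :: "'a::euclidean_space \<Rightarrow> real"
  assumes U: "open U" and f: "convex_on U f" and noline: "\<not> (\<exists>l. is_line l \<and> l \<subseteq> graph_on U f)"
  obtains v b where "\<forall>x\<in>U. 0 \<le> f x - v \<bullet> x + b" "\<forall>c. bounded {x\<in>U. f x - v \<bullet> x + b \<le> c}"
proof (cases "U = {}")
  case True
  then show thesis by (intro that[of 0 0]) auto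
next
  case False
  then obtain x0 where "x0 \<in> U" by blast
  define D where "D = {v. \<exists>c. \<forall>x\<in>U. v \<bullet> x - c \<le> f x}"
  have "convex D"
    unfolding convex_def
  proof (intro ballI allI impI)
    fix v w s t assume "v \<in> D" "w \<in> D" and st: "0 \<le> (s::real)" "0 \<le> t" "s + t = 1"
    then obtain c c' where c: "\<forall>x\<in>U. v \<bullet> x - c \<le> f x" "\<forall>x\<in>U. w \<bullet> x - c' \<le> f x" by (auto simp: D_def)
    have "(s *\<^sub>R v + t *\<^sub>R w) \<bullet> x - (s * c + t * c') \<le> f x" if "x \<in> U" for x
    proof -
      have "s * (v \<bullet> x - c) + t * (w \<bullet> x - c') \<le> s * f x + t * f x"
        using c that st by (intro add_mono mult_left_mono) auto
      also have "\<dots> = (s + t) * f x" by (simp add: algebra_simps)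
      finally show ?thesis using st by (simp add: inner_add_left algebra_simps)
    qed
    then show "s *\<^sub>R v + t *\<^sub>R w \<in> D" by (auto simp: D_def)
  qed
  have "interior D \<noteq> {}"
  proof
    assume "interior D = {}"
    then obtain a b where "a \<noteq> 0" "D \<subseteq> {x. a \<bullet> x = b}"
      using empty_interior_subset_hyperplane[OF \<open>convex D\<close>] by metis
    then show False
      using line_of_subgradients_in_hyperplane[OF U f \<open>x0 \<in> U\<close>, of a b] noline by (auto simp: D_def)
  qed
  then obtain v e where "e > 0" and e: "cball v e \<subseteq> D"
    by (metis all_not_in_conv mem_interior_cball)
  then have "v \<in> D" by auto
  then obtain b where b: "\<forall>x\<in>U. v \<bullet> x - b \<le> f x" by (auto simp: D_def)
  have "\<exists>c. \<forall>x\<in>U. (v + u) \<bullet> x - c \<le> f x" if "norm u = e" for u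
  proof -
    have "v + u \<in> D" using e that by (auto simp: subset_iff dist_norm)
    then show ?thesis by (simp add: D_def)
  qed
  then obtain c where c: "\<And>u x. norm u = e \<Longrightarrow> x \<in> U \<Longrightarrow> (v + u) \<bullet> x - c u \<le> f x" by metis
  have "bounded {x\<in>U. f x - v \<bullet> x + b \<le> K}" for K
  proof (rule boundedI)
    fix x assume x: "x \<in> {x\<in>U. f x - v \<bullet> x + b \<le> K}"
    have "\<bar>x \<bullet> i\<bar> \<le> (\<bar>K\<bar> + \<bar>b\<bar> + \<bar>c (e *\<^sub>R i)\<bar> + \<bar>c (- (e *\<^sub>R i))\<bar>) / e" if "i \<in> Basis" for i
    proof -
      have "norm (e *\<^sub>R i) = e" "norm (- (e *\<^sub>R i)) = e" using that \<open>e > 0\<close> by auto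
      then have "(v + e *\<^sub>R i) \<bullet> x - c (e *\<^sub>R i) \<le> f x" "(v + - (e *\<^sub>R i)) \<bullet> x - c (- (e *\<^sub>R i)) \<le> f x"
        using c x by blast+
      then have "e * (x \<bullet> i) \<le> \<bar>K\<bar> + \<bar>b\<bar> + \<bar>c (e *\<^sub>R i)\<bar> + \<bar>c (- (e *\<^sub>R i))\<bar>"
        "- (e * (x \<bullet> i)) \<le> \<bar>K\<bar> + \<bar>b\<bar> + \<bar>c (e *\<^sub>R i)\<bar> + \<bar>c (- (e *\<^sub>R i))\<bar>"
        using x by (auto simp: inner_add_left inner_diff_left inner_commute[of i x])
      then have "e * \<bar>x \<bullet> i\<bar> \<le> \<bar>K\<bar> + \<bar>b\<bar> + \<bar>c (e *\<^sub>R i)\<bar> + \<bar>c (- (e *\<^sub>R i))\<bar>"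
        using \<open>e > 0\<close> by (cases "x \<bullet> i \<ge> 0") (simp_all add: abs_if)
      then show ?thesis using \<open>e > 0\<close> by (simp add: pos_le_divide_eq mult.commute)
    qed
    then have "(\<Sum>i\<in>Basis. \<bar>x \<bullet> i\<bar>) \<le> (\<Sum>i\<in>Basis. (\<bar>K\<bar> + \<bar>b\<bar> + \<bar>c (e *\<^sub>R i)\<bar> + \<bar>c (- (e *\<^sub>R i))\<bar>) / e)"
      by (rule sum_mono)
    then show "norm x \<le> (\<Sum>i\<in>Basis. (\<bar>K\<bar> + \<bar>b\<bar> + \<bar>c (e *\<^sub>R i)\<bar> + \<bar>c (- (e *\<^sub>R i))\<bar>) / e)"
      using norm_le_l1 order_trans by blast
  qed
  then show thesis using b by (intro that[of v b]) (auto simp: algebra_simps)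
qed

lemma C11_loc_on_add_affine:
  fixes g :: "'a::euclidean_space \<Rightarrow> real"
  assumes "C11_loc_on U g"
  shows "C11_loc_on U (\<lambda>x. g x + (v \<bullet> x + b))"
proof -
  obtain Dg where Dg: "\<forall>x\<in>U. (g has_derivative blinfun_apply (Dg x)) (at x)" "continuous_on U Dg"
      "\<forall>x\<in>U. \<exists>r>0. \<exists>L. L-lipschitz_on (ball x r \<inter> U) Dg"
    using assms unfolding C11_loc_on_def by blast
  show ?thesis
    unfolding C11_loc_on_def
  proof (intro exI[of _ "\<lambda>x. Dg x + blinfun_inner_left v"] conjI ballI)
    fix x assume x: "x \<in> U"
    show "((\<lambda>x. g x + (v \<bullet> x + b)) has_derivative blinfun_apply (Dg x + blinfun_inner_left v)) (at x)"
      by (auto intro!: derivative_eq_intros bspec[OF Dg(1) x] simp: blinfun.add_left inner_commute)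
    show "\<exists>r>0. \<exists>L. L-lipschitz_on (ball x r \<inter> U) (\<lambda>x. Dg x + blinfun_inner_left v)"
      using bspec[OF Dg(3) x] by (simp add: lipschitz_on_def)
  qed (intro continuous_intros Dg)
qed

lemma convex_on_add_affine:
  fixes g :: "'a::euclidean_space \<Rightarrow> real"
  assumes "convex_on U g"
  shows "convex_on U (\<lambda>x. g x + (v \<bullet> x + b))"
  unfolding convex_on_def
proof (intro conjI ballI allI impI)
  show "convex U" using assms by (rule convex_on_imp_convex)
  fix x y s t assume *: "x \<in> U" "y \<in> U" "0 \<le> (s::real)" "0 \<le> t" "s + t = 1"
  then have "g (s *\<^sub>R x + t *\<^sub>R y) \<le> s * g x + t * g y" using assms by (auto simp: convex_on_def)
  moreover have "b = s * b + t * b" using *(5) by (metis distrib_right mult_1)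
  ultimately show "g (s *\<^sub>R x + t *\<^sub>R y) + (v \<bullet> (s *\<^sub>R x + t *\<^sub>R y) + b)
      \<le> s * (g x + (v \<bullet> x + b)) + t * (g y + (v \<bullet> y + b))"
    by (simp add: inner_add_right algebra_simps)
qed

lemma neq_set_open:
  fixes f g :: "'a::euclidean_space \<Rightarrow> real"
  assumes "open U" "continuous_on U f" "continuous_on U g"
  shows "open {x\<in>U. f x \<noteq> g x}"
proof -
  have "open (U \<inter> (\<lambda>x. f x - g x) -` (- {0}))"
    by (rule continuous_open_preimage) (use assms in \<open>auto intro: continuous_intros\<close>)
  also have "U \<inter> (\<lambda>x. f x - g x) -` (- {0}) = {x\<in>U. f x \<noteq> g x}" by auto
  finally show ?thesis .
qed

lemma C11_approximation_of_no_line: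
  fixes f :: "'a::euclidean_space \<Rightarrow> real"
  assumes U: "open U" and f: "convex_on U f" and noline: "\<not> (\<exists>l. is_line l \<and> l \<subseteq> graph_on U f)"
    and "\<epsilon> > 0"
  obtains g where "convex_on U g" "C11_loc_on U g"
    "emeasure lebesgue {x\<in>U. f x \<noteq> g x} < ennreal \<epsilon>" "\<forall>x\<in>U. f x \<le> g x"
proof -
  obtain v b where nonneg: "\<forall>x\<in>U. 0 \<le> f x - v \<bullet> x + b" and bdd: "\<forall>c. bounded {x\<in>U. f x - v \<bullet> x + b \<le> c}"
    using coercive_tilt[OF U f noline] .
  define F where "F x = f x + ((- v) \<bullet> x + b)" for x
  have F: "convex_on U F" unfolding F_def by (rule convex_on_add_affine[OF f])
  have Feq: "F x = f x - v \<bullet> x + b" for x by (simp add: F_def)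
  have Fnonneg: "0 \<le> F x" if "x \<in> U" for x using nonneg that by (simp only: Feq)
  have Fbdd: "bounded {x\<in>U. F x \<le> c}" for c using bdd by (simp only: Feq)
  have "\<epsilon> / 2 > 0" using \<open>\<epsilon> > 0\<close> by simp
  obtain h where h: "convex_on U h" "\<forall>x\<in>U. F x \<le> h x" "\<forall>c. compact {x\<in>U. h x \<le> c}"
    "emeasure lebesgue {x\<in>U. F x \<noteq> h x} < ennreal (\<epsilon> / 2)"
    by (rule compact_sublevel_majorant[OF U F Fnonneg Fbdd \<open>\<epsilon> / 2 > 0\<close>]) (assumption, rule that)
  have hnonneg: "0 \<le> h x" if "x \<in> U" for x using h(2) Fnonneg that by force
  obtain g where g: "convex_on U g" "C11_loc_on U g" "\<And>x. x \<in> U \<Longrightarrow> h x \<le> g x"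
    "emeasure lebesgue {x\<in>U. h x \<noteq> g x} < ennreal (\<epsilon> / 2)"
    using C11_approximation_of_compact_sublevels[OF U h(1) hnonneg spec[OF h(3)] \<open>\<epsilon> / 2 > 0\<close>] by blast
  note cont = convex_on_continuous[OF U]
  have "{x\<in>U. f x \<noteq> g x + (v \<bullet> x + (- b))} \<subseteq> {x\<in>U. F x \<noteq> h x} \<union> {x\<in>U. h x \<noteq> g x}"
    by (auto simp: F_def)
  then have "emeasure lebesgue {x\<in>U. f x \<noteq> g x + (v \<bullet> x + (- b))}
      \<le> emeasure lebesgue ({x\<in>U. F x \<noteq> h x} \<union> {x\<in>U. h x \<noteq> g x})"
    using neq_set_open[OF U cont[OF F] cont[OF h(1)]] neq_set_open[OF U cont[OF h(1)] cont[OF g(1)]]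
    by (intro emeasure_mono) auto
  also have "\<dots> \<le> emeasure lebesgue {x\<in>U. F x \<noteq> h x} + emeasure lebesgue {x\<in>U. h x \<noteq> g x}"
    using neq_set_open[OF U cont[OF F] cont[OF h(1)]] neq_set_open[OF U cont[OF h(1)] cont[OF g(1)]]
    by (intro emeasure_subadditive) auto
  also have "\<dots> < ennreal (\<epsilon> / 2) + ennreal (\<epsilon> / 2)"
    using h(4) g(4) by (rule add_strict_mono)
  also have "\<dots> = ennreal \<epsilon>" using \<open>\<epsilon> > 0\<close> by (simp flip: ennreal_plus)
  finally have m: "emeasure lebesgue {x\<in>U. f x \<noteq> g x + (v \<bullet> x + (- b))} < ennreal \<epsilon>" .
  have "f x \<le> g x + (v \<bullet> x + (- b))" if "x \<in> U" for x
    using h(2) g(3)[OF that] that by (fastforce simp: F_def)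
  then show thesis
    using that[OF convex_on_add_affine[OF g(1)] C11_loc_on_add_affine[OF g(2)] m] by blast
qed

section \<open>Graphs containing a line\<close>

text \<open>Isometries of the real line into an inner product space are affine: the distances of the
  image of \<open>t\<close> to those of 0 and 1 fix \<open>u \<bullet> w = t\<close>, and then
  equality in Cauchy-Schwarz gives \<open>u = t *\<^sub>R w\<close>. The direction is not vertical
  because the line lies in a graph.\<close>

lemma line_in_graph:
  fixes f :: "'a::euclidean_space \<Rightarrow> real"
  assumes "is_line l" "l \<subseteq> graph_on U f"
  obtains x0 v s where "v \<noteq> 0" "\<forall>t. x0 + t *\<^sub>R v \<in> U" "\<forall>t. f (x0 + t *\<^sub>R v) = f x0 + t * s"
proof -
  obtain \<gamma> :: "real \<Rightarrow> 'a \<times> real" where \<gamma>: "range \<gamma> = l" "\<And>s t. dist (\<gamma> s) (\<gamma> t) = dist s t"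
    using assms(1) by (auto simp: is_line_def)
  define w where "w = \<gamma> 1 - \<gamma> 0"
  have nw: "w \<bullet> w = 1"
    using \<gamma>(2)[of 1 0] by (simp add: w_def dist_norm dot_square_norm)
  have aff: "\<gamma> t = \<gamma> 0 + t *\<^sub>R w" for t
  proof -
    define u where "u = \<gamma> t - \<gamma> 0"
    have "norm u = \<bar>t\<bar>" using \<gamma>(2)[of t 0] by (simp add: u_def dist_norm)
    then have uu: "u \<bullet> u = t\<^sup>2" by (simp add: dot_square_norm)
    have "u - w = \<gamma> t - \<gamma> 1" by (simp add: u_def w_def)
    then have "norm (u - w) = \<bar>t - 1\<bar>" using \<gamma>(2)[of t 1] by (simp add: dist_norm dist_real_def)
    then have "(u - w) \<bullet> (u - w) = (t - 1)\<^sup>2" by (simp add: dot_square_norm)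
    then have "u \<bullet> w = t"
      using uu nw by (simp add: inner_diff_left inner_diff_right inner_commute power2_eq_square algebra_simps)
    then have "(u - t *\<^sub>R w) \<bullet> (u - t *\<^sub>R w) = 0"
      using uu nw by (simp add: inner_diff_left inner_diff_right inner_commute power2_eq_square)
    then have "u = t *\<^sub>R w" by simp
    then show ?thesis by (simp add: u_def algebra_simps)
  qed
  have mem: "\<gamma> t \<in> graph_on U f" for t using \<gamma>(1) assms(2) by blast
  define x0 v s where "x0 = fst (\<gamma> 0)" and "v = fst w" and "s = snd w"
  have g: "x0 + t *\<^sub>R v \<in> U \<and> f (x0 + t *\<^sub>R v) = snd (\<gamma> 0) + t * s" for t
    using mem[of t] aff[of t] by (auto simp: graph_on_def x0_def v_def s_def prod_eq_iff)
  have f0: "f x0 = snd (\<gamma> 0)" using g[of 0] by simp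
  have "v \<noteq> 0"
  proof
    assume "v = 0"
    then have "s = 0" using g[of 1] f0 by simp
    then have "w = 0" using \<open>v = 0\<close> by (simp add: v_def s_def prod_eq_iff)
    then show False using nw by simp
  qed
  then show thesis using that g f0 by metis
qed

text \<open>\<open>v\<close> is a recession direction: points on the parallel through
  \<open>x\<close> are convex combinations of a fixed point and far points of the given line. This
  bounds \<open>f\<close> by an affine function of slope \<open>s\<close>; convexity removes the
  excess constant, and moving back by \<open>- t\<close> gives the reverse inequality.\<close>

lemma affine_along_line:
  fixes f :: "'a::euclidean_space \<Rightarrow> real"
  assumes U: "open U" and f: "convex_on U f"
    and line: "\<forall>t. x0 + t *\<^sub>R v \<in> U" "\<forall>t. f (x0 + t *\<^sub>R v) = f x0 + t * s"
    and x: "x \<in> U"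
  shows "x + t *\<^sub>R v \<in> U \<and> f (x + t *\<^sub>R v) = f x + t * s"
proof -
  have cU: "convex U" using f by (rule convex_on_imp_convex)
  have bound: "\<exists>K. \<forall>t. x + t *\<^sub>R v \<in> U \<and> f (x + t *\<^sub>R v) \<le> K + t * s" if x: "x \<in> U" for x
  proof -
    obtain e where "e > 0" and e: "cball x e \<subseteq> U" using U x open_contains_cball by blast
    \<comment> \<open>\<delta> is so small that \<open>x\<close>, pushed slightly away from
      \<open>x0\<close>, stays in \<open>U\<close>; thus \<open>x\<close> is strictly between
      \<open>x'\<close> and \<open>x0\<close>, with weight \<open>q > 0\<close> at
      \<open>x0\<close>.\<close>
    define \<delta> where "\<delta> = e / (norm (x - x0) + 1)"
    have "\<delta> > 0" using \<open>e > 0\<close> by (simp add: \<delta>_def add_nonneg_pos)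
    define x' where "x' = x + \<delta> *\<^sub>R (x - x0)"
    have "norm (x - x0) * e \<le> (norm (x - x0) + 1) * e" using \<open>e > 0\<close> by (simp add: algebra_simps)
    then have "\<delta> * norm (x - x0) \<le> e"
      by (simp add: \<delta>_def divide_le_eq add_nonneg_pos mult.commute)
    then have x': "x' \<in> U" using e \<open>\<delta> > 0\<close> by (auto simp: x'_def subset_iff dist_norm)
    define p q where "p = 1 / (1 + \<delta>)" and "q = \<delta> / (1 + \<delta>)"
    have pq: "p \<ge> 0" "q > 0" "p + q = 1" "q = \<delta> * p"
      using \<open>\<delta> > 0\<close> by (auto simp: p_def q_def add_divide_distrib[symmetric])
    have "p > 0" using \<open>\<delta> > 0\<close> by (simp add: p_def)
    have "x + t *\<^sub>R v \<in> U \<and> f (x + t *\<^sub>R v) \<le> (p * f x' + q * f x0) + t * s" for t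
    proof -
      have eq: "x + t *\<^sub>R v = p *\<^sub>R x' + q *\<^sub>R (x0 + (t / q) *\<^sub>R v)"
      proof -
        have "p *\<^sub>R x' + q *\<^sub>R (x0 + (t / q) *\<^sub>R v) = (p + q) *\<^sub>R x + t *\<^sub>R v"
          using \<open>\<delta> > 0\<close> \<open>p > 0\<close> by (simp add: x'_def pq(4) scaleR_add_right scaleR_add_left scaleR_diff_right mult.commute)
        then show ?thesis using pq(3) by simp
      qed
      have "f (x + t *\<^sub>R v) \<le> p * f x' + q * f (x0 + (t / q) *\<^sub>R v)"
        unfolding eq using f x' line(1) pq by (auto simp: convex_on_def)
      also have "\<dots> = (p * f x' + q * f x0) + t * s"
        using line(2) pq(2) by (simp add: algebra_simps)
      finally show ?thesis
        unfolding eq using cU x' line(1) pq by (auto simp: convex_def)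
    qed
    then show ?thesis by blast
  qed
  have upper: "x + t *\<^sub>R v \<in> U \<and> f (x + t *\<^sub>R v) \<le> f x + t * s" if x: "x \<in> U" for x t
  proof -
    obtain K where K: "\<And>t. x + t *\<^sub>R v \<in> U" "\<And>t. f (x + t *\<^sub>R v) \<le> K + t * s" using bound[OF x] by blast
    have "f (x + t *\<^sub>R v) - t * s - f x \<le> e" if "e > 0" for e
    proof -
      \<comment> \<open>The point is seen as a fraction \<open>1 / real n\<close> of the way to a
        point \<open>n\<close> times as far, so the excess \<open>K - f x\<close> is divided by
        \<open>n\<close>.\<close>
      obtain n :: nat where n: "real n > max 1 ((K - f x) / e)" using reals_Archimedean2 by blast
      have "x + t *\<^sub>R v = (1 - 1 / real n) *\<^sub>R x + (1 / real n) *\<^sub>R (x + (real n * t) *\<^sub>R v)"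
        using n by (simp add: algebra_simps)
      then have "f (x + t *\<^sub>R v) \<le> (1 - 1 / real n) * f x + (1 / real n) * f (x + (real n * t) *\<^sub>R v)"
        using convex_onD[OF f _ _ x K(1)[of "real n * t"], of "1 / real n"] n by simp
      also have "\<dots> \<le> (1 - 1 / real n) * f x + (1 / real n) * (K + (real n * t) * s)"
        using K(2) by (intro add_left_mono mult_left_mono) auto
      also have "\<dots> = f x + t * s + (K - f x) / real n"
        using n by (simp add: field_simps)
      finally have "f (x + t *\<^sub>R v) - t * s - f x \<le> (K - f x) / real n" by simp
      also have "\<dots> \<le> e" using n that by (simp add: divide_le_eq pos_divide_less_eq mult.commute less_imp_le)
      finally show ?thesis .
    qed
    then have "f (x + t *\<^sub>R v) - t * s - f x \<le> 0" by (rule field_le_epsilon[of _ 0, simplified])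
    then show ?thesis using K(1) by simp
  qed
  have "f x \<le> f (x + t *\<^sub>R v) - t * s"
    using upper[of "x + t *\<^sub>R v" "- t"] upper[OF x, of t] by simp
  then show ?thesis using upper[OF x, of t] by simp
qed

text \<open>Any point of disagreement has another one among three far translates along
  \<open>v\<close>. So a ball in the open set \<open>A\<close> is covered by three translates of the
  part of \<open>A\<close> far from the origin, which has small measure because \<open>A\<close> has
  finite measure.\<close>

lemma eq_of_finite_measure_neq:
  fixes f g :: "'a::euclidean_space \<Rightarrow> real"
  assumes U: "open U" and f: "convex_on U f" and g: "convex_on U g" and "v \<noteq> 0"
    and aff: "\<And>x t. x \<in> U \<Longrightarrow> x + t *\<^sub>R v \<in> U \<and> f (x + t *\<^sub>R v) = f x + t * s"
    and fin: "emeasure lebesgue {x\<in>U. f x \<noteq> g x} < \<infinity>"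
    and x: "x \<in> U"
  shows "f x = g x"
proof (rule ccontr)
  assume "f x \<noteq> g x"
  define A where "A = {x\<in>U. f x \<noteq> g x}"
  have "open A"
    unfolding A_def using U f g by (intro neq_set_open convex_on_continuous)
  then have Am: "A \<in> lmeasurable" using fin by (auto simp: A_def fmeasurable_def)
  have "x \<in> A" using x \<open>f x \<noteq> g x\<close> by (simp add: A_def)
  then obtain e where "e > 0" and e: "ball x e \<subseteq> A" using \<open>open A\<close> open_contains_ball by blast
  \<comment> \<open>\<open>f\<close> is affine and \<open>g\<close> convex on the line through \<open>y\<close>: agreement at \<open>-N\<close> and \<open>N\<close> gives
    \<open>g y \<le> f y\<close>, agreement at \<open>-2N\<close> and \<open>-N\<close> gives the converse.\<close>
  have shift: "y + (- 2 * N) *\<^sub>R v \<in> A \<or> y + (- N) *\<^sub>R v \<in> A \<or> y + N *\<^sub>R v \<in> A" if y: "y \<in> A" "N > 0" for y N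
  proof (rule ccontr)
    have yU: "y \<in> U" using y by (simp add: A_def)
    have inU: "y + t *\<^sub>R v \<in> U" for t using aff[OF yU] by blast
    assume "\<not> ?thesis"
    then have *: "g (y + t *\<^sub>R v) = f y + t * s" if "t \<in> {- 2 * N, - N, N}" for t
      using that aff[OF yU, of t] by (auto simp: A_def)
    have mid: "g ((1/2) *\<^sub>R a + (1/2) *\<^sub>R b) \<le> g a / 2 + g b / 2" if "a \<in> U" "b \<in> U" for a b
      using convex_onD[OF g, of "1/2" a b] that by simp
    have "(1/2) *\<^sub>R (y + N *\<^sub>R v) + (1/2) *\<^sub>R (y + (- N) *\<^sub>R v) = y"
      by (simp add: scaleR_add_right scaleR_diff_right flip: scaleR_add_left)
    then have "g y \<le> f y"
      using mid[OF inU[of N] inU[of "- N"]] *[of N] *[of "- N"] by (simp add: field_simps)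
    moreover have "(1/2) *\<^sub>R (y + (- 2 * N) *\<^sub>R v) + (1/2) *\<^sub>R y = y + (- N) *\<^sub>R v"
      by (simp add: scaleR_diff_right add_diff_eq flip: scaleR_add_left)
    then have "f y \<le> g y"
      using mid[OF inU[of "- 2 * N"] yU] *[of "- 2 * N"] *[of "- N"] by (simp add: field_simps)
    ultimately show False using y by (simp add: A_def)
  qed
  define \<mu> where "\<mu> = measure lebesgue (ball x e)"
  have "\<mu> > 0" using content_ball_pos[OF \<open>e > 0\<close>, of x] by (simp add: \<mu>_def)
  have Em: "A - cball 0 (real n) \<in> lmeasurable" for n
    by (rule fmeasurable_Diff[OF Am]) simp
  \<comment> \<open>A quarter suffices: three translates have total measure at most
    \<open>3 * \<mu> / 4\<close>, less than that of the ball.\<close>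
  obtain n where n: "emeasure lebesgue (A - cball 0 (real n)) \<le> ennreal (\<mu> / 4)"
  proof (rule decseq_emeasure_small[of "\<lambda>n. A - cball 0 (real n)" "\<mu> / 4"])
    show "decseq (\<lambda>n. A - cball 0 (real n))" by (auto simp: decseq_def)
    have "(\<Inter>n. A - cball 0 (real n)) = {}"
      by (auto simp: real_arch_simple)
    then show "negligible (\<Inter>n. A - cball 0 (real n))" by simp
  qed (use Em \<open>\<mu> > 0\<close> in auto)
  define E where "E = A - cball 0 (real n)"
  have mE: "measure lebesgue E \<le> \<mu> / 4"
    using n Em[of n] \<open>\<mu> > 0\<close> by (simp add: E_def emeasure_eq_measure2)
  \<comment> \<open>Translation by at least \<open>N\<close> times \<open>v\<close>, in either
    sense, carries \<open>ball x e\<close> out of \<open>cball 0 (real n)\<close>.\<close>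
  define N where "N = (real n + norm x + e + 1) / norm v"
  have "N > 0" using \<open>v \<noteq> 0\<close> \<open>e > 0\<close> unfolding N_def by (intro divide_pos_pos) (auto intro: add_nonneg_pos add_pos_pos)
  have Nv: "N * norm v = real n + norm x + e + 1" using \<open>v \<noteq> 0\<close> by (simp add: N_def)
  have far: "y + t *\<^sub>R v \<notin> cball 0 (real n)" if "y \<in> ball x e" "\<bar>t\<bar> \<ge> N" for y t
  proof -
    have "N * norm v \<le> \<bar>t\<bar> * norm v" using that by (intro mult_right_mono) auto
    moreover have "norm y \<le> norm x + e"
      using that(1) norm_triangle_ineq2[of y x] by (simp add: dist_norm norm_minus_commute)
    moreover have "\<bar>t\<bar> * norm v \<le> norm (y + t *\<^sub>R v) + norm y"
      using norm_triangle_ineq4[of "y + t *\<^sub>R v" y] by simp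
    ultimately show ?thesis using Nv by simp
  qed
  have "ball x e \<subseteq> (\<Union>t\<in>{- 2 * N, - N, N}. (\<lambda>z. - (t *\<^sub>R v) + z) ` E)"
  proof
    fix y assume y: "y \<in> ball x e"
    then have "y \<in> A" using e by blast
    then obtain t where t: "t \<in> {- 2 * N, - N, N}" "y + t *\<^sub>R v \<in> A" using shift[OF _ \<open>N > 0\<close>, of y] by blast
    then have "\<bar>t\<bar> \<ge> N" using \<open>N > 0\<close> by auto
    then have "y + t *\<^sub>R v \<in> E" using far[OF y] t by (simp add: E_def)
    then have "y \<in> (\<lambda>z. - (t *\<^sub>R v) + z) ` E" by (rule rev_image_eqI) simp
    then show "y \<in> (\<Union>t\<in>{- 2 * N, - N, N}. (\<lambda>z. - (t *\<^sub>R v) + z) ` E)" using t(1) by blast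
  qed
  moreover have Tm: "(\<lambda>z. - (t *\<^sub>R v) + z) ` E \<in> lmeasurable" for t
    using Em[of n] unfolding E_def by (rule measurable_translation)
  ultimately have "\<mu> \<le> measure lebesgue (\<Union>t\<in>{- 2 * N, - N, N}. (\<lambda>z. - (t *\<^sub>R v) + z) ` E)"
    unfolding \<mu>_def by (intro measure_mono_fmeasurable fmeasurable.finite_UN) auto
  also have "\<dots> \<le> (\<Sum>t\<in>{- 2 * N, - N, N}. measure lebesgue ((\<lambda>z. - (t *\<^sub>R v) + z) ` E))"
    using Tm by (intro measure_UNION_le) (auto simp: fmeasurableD)
  also have "\<dots> = (\<Sum>t\<in>{- 2 * N, - N, N}. measure lebesgue E)"
    by (simp only: measure_translation)
  also have "\<dots> = 3 * measure lebesgue E" using \<open>N > 0\<close> by simp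
  also have "\<dots> < \<mu>" using mE \<open>\<mu> > 0\<close> by simp
  finally show False by simp
qed

lemma C11_loc_on_cong:
  fixes f g :: "'a::euclidean_space \<Rightarrow> real"
  assumes U: "open U" and eq: "\<And>x. x \<in> U \<Longrightarrow> f x = g x" and g: "C11_loc_on U g"
  shows "C11_loc_on U f"
proof -
  obtain Dg where Dg: "\<forall>x\<in>U. (g has_derivative blinfun_apply (Dg x)) (at x)" "continuous_on U Dg"
      "\<forall>x\<in>U. \<exists>r>0. \<exists>L. L-lipschitz_on (ball x r \<inter> U) Dg"
    using g unfolding C11_loc_on_def by blast
  have "(f has_derivative blinfun_apply (Dg x)) (at x)" if x: "x \<in> U" for x
    using has_derivative_transform_within_open[OF bspec[OF Dg(1) x] U x] eq by auto
  then show ?thesis unfolding C11_loc_on_def using Dg by blast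
qed

theorem theorem1p8:
  fixes U :: "(real ^ 'n) set" and f :: "real ^ 'n \<Rightarrow> real"
  assumes "open U" and "convex U" and "convex_on U f" and "\<not> C11_loc_on U f"
  shows "((\<forall>\<epsilon>>0. \<exists>g. convex_on U g \<and> C11_loc_on U g \<and>
              emeasure lebesgue {x \<in> U. f x \<noteq> g x} < ennreal \<epsilon>)
          \<longleftrightarrow> \<not> (\<exists>l. is_line l \<and> l \<subseteq> graph_on U f))
       \<and> (\<not> (\<exists>l. is_line l \<and> l \<subseteq> graph_on U f) \<longrightarrow>
            (\<forall>\<epsilon>>0. \<exists>g. convex_on U g \<and> C11_loc_on U g \<and>
              emeasure lebesgue {x \<in> U. f x \<noteq> g x} < ennreal \<epsilon> \<and>
              (\<forall>x\<in>U. g x \<ge> f x)))"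
proof -
  note U = \<open>open U\<close> and f = \<open>convex_on U f\<close>
  have approx: "\<exists>g. convex_on U g \<and> C11_loc_on U g \<and>
      emeasure lebesgue {x \<in> U. f x \<noteq> g x} < ennreal \<epsilon> \<and> (\<forall>x\<in>U. g x \<ge> f x)"
    if "\<not> (\<exists>l. is_line l \<and> l \<subseteq> graph_on U f)" "\<epsilon> > 0" for \<epsilon>
    by (rule C11_approximation_of_no_line[OF U f that]) blast
  have "\<not> (\<exists>l. is_line l \<and> l \<subseteq> graph_on U f)"
    if "\<forall>\<epsilon>>0. \<exists>g. convex_on U g \<and> C11_loc_on U g \<and> emeasure lebesgue {x \<in> U. f x \<noteq> g x} < ennreal \<epsilon>"
  proof
    assume "\<exists>l. is_line l \<and> l \<subseteq> graph_on U f"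
    then obtain l where l: "is_line l" "l \<subseteq> graph_on U f" by blast
    obtain x0 v s where line: "v \<noteq> 0" "\<forall>t. x0 + t *\<^sub>R v \<in> U" "\<forall>t. f (x0 + t *\<^sub>R v) = f x0 + t * s"
      by (rule line_in_graph[OF l])
    \<comment> \<open>One value of \<epsilon> is enough: finite measure already forces
      \<open>f = g\<close> on \<open>U\<close>, so \<open>f\<close> would inherit the regularity of
      \<open>g\<close>.\<close>
    from that[rule_format, of 1] obtain g where g: "convex_on U g" "C11_loc_on U g"
      "emeasure lebesgue {x \<in> U. f x \<noteq> g x} < ennreal 1" by auto
    have "emeasure lebesgue {x \<in> U. f x \<noteq> g x} < \<infinity>"
      using g(3) by (rule less_trans) simp
    then have "f x = g x" if "x \<in> U" for x
      using eq_of_finite_measure_neq[OF U f g(1) line(1) affine_along_line[OF U f line(2,3)]] that by blast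
    then have "C11_loc_on U f" by (rule C11_loc_on_cong[OF U _ g(2)])
    with \<open>\<not> C11_loc_on U f\<close> show False by contradiction
  qed
  then show ?thesis using approx by blast
qed

end
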